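(* The set of transition points of the parametric second-order conic optimization problem $(\mathrm{P}_\epsilon)$–$(\mathrm{D}_\epsilon)$ is finite.
   Context: Setting. Let $\mathbb{L}^{n_i}_+=\{x^i\in\mathbb{R}^{n_i}: x^i_1\ge\|x^i_{2:n_i}\|\}$ ($\|\cdot\|$ the $\ell_2$ norm), with interior $\mathrm{int}(\mathbb{L}^{n_i}_+)=\{x^i: x^i_1>\|x^i_{2:n_i}\|\}$ and boundary $\mathrm{bd}(\mathbb{L}^{n_i}_+)=\{x^i: x^i_1=\|x^i_{2:n_i}\|\}$. Let $\mathcal{L}^{\bar n}_+=\mathbb{L}^{n_1}_+\times\cdots\times\mathbb{L}^{n_p}_+$, $\bar n=\sum_{i=1}^p n_i$. Data: $A=(A^1,\ldots,A^p)\in\mathbb{R}^{m\times\bar n}$ with $A^i\in\mathbb{R}^{m\times n_i}$, $b\in\mathbb{R}^m$, $c,\bar c\in\mathbb{R}^{\bar n}$, $\bar c\ne0$ fixed. For $\epsilon\in\mathbb{R}$ consider $(\mathrm{P}_\epsilon)$: $\inf_x\{(c+\epsilon\bar c)^Tx: Ax=b,\ x\in\mathcal{L}^{\bar n}_+\}$ and $(\mathrm{D}_\epsilon)$: $\sup_{(y;s)}\{b^Ty: A^Ty+s=c+\epsilon\bar c,\ s\in\mathcal{L}^{\bar n}_+\}$, with vectors partitioned as $x=(x^1;\ldots;x^p)$, $s=(s^1;\ldots;s^p)$. Standing assumptions: $A$ has full row rank, and at $\epsilon=0$ there is a feasible $(x;y;s)$ of $(\mathrm{P}_0)$ and $(\mathrm{D}_0)$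 with $x^i,s^i\in\mathrm{int}(\mathbb{L}^{n_i}_+)$ for all $i$. $\psi(\epsilon)\in\mathbb{R}\cup\{\pm\infty\}$ is the optimal value of $(\mathrm{P}_\epsilon)$; $\mathcal{E}=\{\epsilon:\psi(\epsilon)\in\mathbb{R}\}$, which is a non-singleton closed interval. The optimal sets are $\mathcal{P}^*(\epsilon)=\{x\in\mathcal{L}^{\bar n}_+: Ax=b,\ (c+\epsilon\bar c)^Tx=\psi(\epsilon)\}$ and $\mathcal{D}^*(\epsilon)=\{(y;s): s\in\mathcal{L}^{\bar n}_+,\ A^Ty+s=c+\epsilon\bar c,\ b^Ty=\psi(\epsilon)\}$; they are nonempty and compact for $\epsilon\in\mathrm{int}(\mathcal{E})$. Optimal partition. $\mathcal{B}(\epsilon)=\{i:\exists x\in\mathcal{P}^*(\epsilon),\ x^i\in\mathrm{int}(\mathbb{L}^{n_i}_+)\}$; $\mathcal{N}(\epsilon)=\{i:\exists (y;s)\in\mathcal{D}^*(\epsilon),\ s^i\in\mathrm{int}(\mathbb{L}^{n_i}_+)\}$; $\mathcal{R}(\epsilon)=\{i:\exists (x;y;s)\in\mathcal{P}^*(\epsilon)\times\mathcal{D}^*(\epsilon),\ x^i,s^i\in\mathrm{bd}(\mathbb{L}^{n_i}_+)\setminus\{0\}\}$; $\mathcal{T}(\epsilon)=\{1,\ldots,p\}\setminus(\mathcal{B}(\epsilon)\cup\mathcal{N}(\epsilon)\cup\mathcal{R}(\epsilon))$. $\mathcal{T}(\epsilon)$ is further partitioned into $\mathcal{T}_1(\epsilon)=\{i\in\mathcal{T}(\epsilon):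 x^i=s^i=0\ \forall (x;y;s)\in\mathcal{P}^*(\epsilon)\times\mathcal{D}^*(\epsilon)\}$; $\mathcal{T}_2(\epsilon)=\{i\in\mathcal{T}(\epsilon):\exists x\in\mathcal{P}^*(\epsilon),\ x^i\in\mathrm{bd}(\mathbb{L}^{n_i}_+)\setminus\{0\}$, and $s^i=0\ \forall (y;s)\in\mathcal{D}^*(\epsilon)\}$; $\mathcal{T}_3(\epsilon)=\{i\in\mathcal{T}(\epsilon):\exists (y;s)\in\mathcal{D}^*(\epsilon),\ s^i\in\mathrm{bd}(\mathbb{L}^{n_i}_+)\setminus\{0\}$, and $x^i=0\ \forall x\in\mathcal{P}^*(\epsilon)\}$. The optimal partition is $\pi(\epsilon)=\{\mathcal{B}(\epsilon),\mathcal{N}(\epsilon),\mathcal{R}(\epsilon),\mathcal{T}(\epsilon)\}$ with $\mathcal{T}(\epsilon)=\{\mathcal{T}_1(\epsilon),\mathcal{T}_2(\epsilon),\mathcal{T}_3(\epsilon)\}$; equality of optimal partitions means equality of all these index sets. A maximally complementary optimal solution at $\epsilon$ is $(x^*(\epsilon);y^*(\epsilon);s^*(\epsilon))$ with $x^*(\epsilon)$ in the relative interior of $\mathcal{P}^*(\epsilon)$ and $(y^*(\epsilon);s^*(\epsilon))$ in the relative interior of $\mathcal{D}^*(\epsilon)$. Write $\mathbb{R}_+x=\{\zeta x:\zeta\ge0\}$. Invariancy set: a maximal subset $\mathcal{E}_{\mathrm{inv}}$ of $\mathrm{int}(\mathcal{E})$ such that $\pi(\epsilon')=\pi(\epsilon'')$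 for all $\epsilon',\epsilon''\in\mathcal{E}_{\mathrm{inv}}$ and the rays $\mathbb{R}_+x^{*i}(\epsilon)$ for $i\in\mathcal{R}(\epsilon)\cup\mathcal{T}_2(\epsilon)$ and $\mathbb{R}_+s^{*i}(\epsilon)$ for $i\in\mathcal{R}(\epsilon)\cup\mathcal{T}_3(\epsilon)$ do not vary with $\epsilon\in\mathcal{E}_{\mathrm{inv}}$, where $(x^*(\epsilon);y^*(\epsilon);s^*(\epsilon))$ is any maximally complementary optimal solution at $\epsilon$ (the rays do not depend on this choice). Transition point: a point $\bar\epsilon\in\mathrm{int}(\mathcal{E})$ such that $\{\bar\epsilon\}$ is a (singleton) invariancy set and for every $\varsigma>0$ (with $(\bar\epsilon-\varsigma,\bar\epsilon+\varsigma)\subseteq\mathrm{int}(\mathcal{E})$) there is $\epsilon\in(\bar\epsilon-\varsigma,\bar\epsilon+\varsigma)$ with $\pi(\epsilon)\ne\pi(\bar\epsilon)$. *)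

theory Defs
  imports "HOL-Analysis.Analysis"
begin

text \<open>
  A block \<open>x\<^sup>i\<close>, an element of \<open>\<real>\<^sup>d\<close> with \<open>d = n i\<close> varying with \<open>i\<close>, is a function \<open>v :: nat \<Rightarrow> real\<close>
  with coordinates \<open>v 1, \<dots>, v d\<close> and value \<open>0\<close> elsewhere.
\<close>

definition euclid :: "nat \<Rightarrow> (nat \<Rightarrow> real) set" where
  "euclid d = {v. \<forall>j. j \<notin> {1..d} \<longrightarrow> v j = 0}"

definition soc :: "nat \<Rightarrow> (nat \<Rightarrow> real) set" where
  "soc d = {v \<in> euclid d. v 1 \<ge> L2_set v {2..d}}"

definition soc_int :: "nat \<Rightarrow> (nat \<Rightarrow> real) set" where
  "soc_int d = {v \<in> euclid d. v 1 > L2_set v {2..d}}"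

definition soc_bd :: "nat \<Rightarrow> (nat \<Rightarrow> real) set" where
  "soc_bd d = {v \<in> euclid d. v 1 = L2_set v {2..d}}"

definition zero_block :: "nat \<Rightarrow> real" where
  "zero_block = (\<lambda>j. 0)"

definition ray :: "(nat \<Rightarrow> real) \<Rightarrow> (nat \<Rightarrow> real) set" where
  "ray v = {(\<lambda>j. \<zeta> * v j) | \<zeta>. \<zeta> \<ge> 0}"

text \<open>
  The stacked vector \<open>x = (x\<^sup>1; \<dots>; x\<^sup>p)\<close> lives in \<open>real ^ 'n\<close>; \<open>idx i j\<close> is the coordinate of \<open>x\<close>
  holding the \<open>j\<close>-th entry of block \<open>i\<close>. In \<open>parametric_soco\<close> below, \<open>idx\<close> is a bijection from
  the pairs \<open>(i, j)\<close> with \<open>1 \<le> i \<le> p\<close> and \<open>1 \<le> j \<le> n i\<close> onto \<open>'n\<close>, so \<open>CARD('n) = n 1 + \<dots> + n p\<close>.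
\<close>

locale soco_data =
  fixes p :: nat
    and n :: "nat \<Rightarrow> nat"
    and idx :: "nat \<Rightarrow> nat \<Rightarrow> 'n::finite"
    and A :: "real ^ 'n ^ 'm::finite"
    and b :: "real ^ 'm"
    and c cbar :: "real ^ 'n"
begin

definition block :: "real ^ 'n \<Rightarrow> nat \<Rightarrow> (nat \<Rightarrow> real)" where
  "block x i = (\<lambda>j. if j \<in> {1..n i} then x $ idx i j else 0)"

definition cone_prod :: "(real ^ 'n) set" where
  "cone_prod = {x. \<forall>i\<in>{1..p}. block x i \<in> soc (n i)}"

definition cost :: "real \<Rightarrow> real ^ 'n" where
  "cost \<epsilon> = c + \<epsilon> *\<^sub>R cbar"

definition primal_feasible :: "(real ^ 'n) set" where
  "primal_feasible = {x \<in> cone_prod. A *v x = b}"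

definition dual_feasible :: "real \<Rightarrow> ((real ^ 'm) \<times> (real ^ 'n)) set" where
  "dual_feasible \<epsilon> = {(y, s). s \<in> cone_prod \<and> transpose A *v y + s = cost \<epsilon>}"

definition \<psi> :: "real \<Rightarrow> ereal" where
  "\<psi> \<epsilon> = (INF x\<in>primal_feasible. ereal (cost \<epsilon> \<bullet> x))"

definition \<E> :: "real set" where
  "\<E> = {\<epsilon>. \<psi> \<epsilon> \<in> range ereal}"

definition primal_opt :: "real \<Rightarrow> (real ^ 'n) set" where
  "primal_opt \<epsilon> = {x \<in> primal_feasible. ereal (cost \<epsilon> \<bullet> x) = \<psi> \<epsilon>}"

definition dual_opt :: "real \<Rightarrow> ((real ^ 'm) \<times> (real ^ 'n)) set" where
  "dual_opt \<epsilon> = {(y, s) \<in> dual_feasible \<epsilon>. ereal (b \<bullet> y) = \<psi> \<epsilon>}"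

definition part_B :: "real \<Rightarrow> nat set" where
  "part_B \<epsilon> = {i \<in> {1..p}. \<exists>x \<in> primal_opt \<epsilon>. block x i \<in> soc_int (n i)}"

definition part_N :: "real \<Rightarrow> nat set" where
  "part_N \<epsilon> = {i \<in> {1..p}. \<exists>(y, s) \<in> dual_opt \<epsilon>. block s i \<in> soc_int (n i)}"

definition part_R :: "real \<Rightarrow> nat set" where
  "part_R \<epsilon> = {i \<in> {1..p}. \<exists>x \<in> primal_opt \<epsilon>. \<exists>(y, s) \<in> dual_opt \<epsilon>.
      block x i \<in> soc_bd (n i) - {zero_block} \<and> block s i \<in> soc_bd (n i) - {zero_block}}"

definition part_T :: "real \<Rightarrow> nat set" where
  "part_T \<epsilon> = {1..p} - (part_B \<epsilon> \<union> part_N \<epsilon> \<union> part_R \<epsilon>)"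

definition part_T1 :: "real \<Rightarrow> nat set" where
  "part_T1 \<epsilon> = {i \<in> part_T \<epsilon>. \<forall>x \<in> primal_opt \<epsilon>. \<forall>(y, s) \<in> dual_opt \<epsilon>.
      block x i = zero_block \<and> block s i = zero_block}"

definition part_T2 :: "real \<Rightarrow> nat set" where
  "part_T2 \<epsilon> = {i \<in> part_T \<epsilon>.
      (\<exists>x \<in> primal_opt \<epsilon>. block x i \<in> soc_bd (n i) - {zero_block}) \<and>
      (\<forall>(y, s) \<in> dual_opt \<epsilon>. block s i = zero_block)}"

definition part_T3 :: "real \<Rightarrow> nat set" where
  "part_T3 \<epsilon> = {i \<in> part_T \<epsilon>.
      (\<exists>(y, s) \<in> dual_opt \<epsilon>. block s i \<in> soc_bd (n i) - {zero_block}) \<and>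
      (\<forall>x \<in> primal_opt \<epsilon>. block x i = zero_block)}"

definition optimal_partition ::
  "real \<Rightarrow> (nat set \<times> nat set \<times> nat set \<times> nat set) \<times> (nat set \<times> nat set \<times> nat set)" where
  "optimal_partition \<epsilon> =
     ((part_B \<epsilon>, part_N \<epsilon>, part_R \<epsilon>, part_T \<epsilon>), (part_T1 \<epsilon>, part_T2 \<epsilon>, part_T3 \<epsilon>))"

definition max_compl :: "real \<Rightarrow> real ^ 'n \<Rightarrow> real ^ 'm \<Rightarrow> real ^ 'n \<Rightarrow> bool" where
  "max_compl \<epsilon> x y s \<longleftrightarrow> x \<in> rel_interior (primal_opt \<epsilon>) \<and> (y, s) \<in> rel_interior (dual_opt \<epsilon>)"

text \<open>
  The rays of maximally complementary solutions do not depend on the chosen solution, so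
  quantifying over all choices below agrees with fixing one choice for each parameter value.
\<close>

definition invariant_on :: "real set \<Rightarrow> bool" where
  "invariant_on S \<longleftrightarrow> S \<subseteq> interior \<E> \<and>
     (\<forall>\<epsilon>'\<in>S. \<forall>\<epsilon>''\<in>S.
        optimal_partition \<epsilon>' = optimal_partition \<epsilon>'' \<and>
        (\<forall>x' y' s' x'' y'' s''. max_compl \<epsilon>' x' y' s' \<longrightarrow> max_compl \<epsilon>'' x'' y'' s'' \<longrightarrow>
           (\<forall>i \<in> part_R \<epsilon>' \<union> part_T2 \<epsilon>'. ray (block x' i) = ray (block x'' i)) \<and>
           (\<forall>i \<in> part_R \<epsilon>' \<union> part_T3 \<epsilon>'. ray (block s' i) = ray (block s'' i))))"

definition invariancy_set :: "real set \<Rightarrow> bool" where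
  "invariancy_set S \<longleftrightarrow> invariant_on S \<and> (\<forall>S'. invariant_on S' \<longrightarrow> S \<subseteq> S' \<longrightarrow> S' = S)"

definition transition_point :: "real \<Rightarrow> bool" where
  "transition_point \<epsilon>\<^sub>0 \<longleftrightarrow> \<epsilon>\<^sub>0 \<in> interior \<E> \<and> invariancy_set {\<epsilon>\<^sub>0} \<and>
     (\<forall>\<delta>>0. {\<epsilon>\<^sub>0 - \<delta><..<\<epsilon>\<^sub>0 + \<delta>} \<subseteq> interior \<E> \<longrightarrow>
        (\<exists>\<epsilon>\<in>{\<epsilon>\<^sub>0 - \<delta><..<\<epsilon>\<^sub>0 + \<delta>}. optimal_partition \<epsilon> \<noteq> optimal_partition \<epsilon>\<^sub>0))"

end

locale parametric_soco = soco_data p n idx A b c cbar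
  for p :: nat
    and n :: "nat \<Rightarrow> nat"
    and idx :: "nat \<Rightarrow> nat \<Rightarrow> 'n::finite"
    and A :: "real ^ 'n ^ 'm::finite"
    and b :: "real ^ 'm"
    and c cbar :: "real ^ 'n" +
  assumes block_dims: "\<And>i. i \<in> {1..p} \<Longrightarrow> n i \<ge> 1"
    and idx_bij: "bij_betw (\<lambda>(i, j). idx i j) (SIGMA i:{1..p}. {1..n i}) UNIV"
    and cbar_nonzero: "cbar \<noteq> 0"
    and full_row_rank: "rank A = CARD('m)"
    and strictly_feasible: "\<exists>x y s. x \<in> primal_feasible \<and> (y, s) \<in> dual_feasible 0 \<and>
      (\<forall>i\<in>{1..p}. block x i \<in> soc_int (n i) \<and> block s i \<in> soc_int (n i))"

end

theory Submission imports Defs begin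

text \<open>
  At a transition point the optimal partition is not locally constant. The partition is determined by
  the truth values of finitely many statements of the form ``some optimal \<open>x\<close> has its block \<open>i\<close> in \<open>K\<close>''
  or ``some optimal \<open>(y, s)\<close> has the block \<open>i\<close> of \<open>s\<close> in \<open>K\<close>'' (\<open>optimal_partition_eqI\<close>), so every
  transition point lies on the frontier of the set of parameters \<open>\<epsilon>\<close> for which one of these statements
  holds (\<open>transition_point_in_frontier\<close>). It therefore suffices that these sets have finite frontier.

  Each of them is definable by a first-order formula over the ordered field of the reals. The
  second-order cone is given by quadratic inequalities, and optimality says that no feasible competitor
  is better (\<open>primal_opt_iff\<close>), or, for the dual problem, that the objective value is the infimum of
  the primal costs (\<open>dual_opt_iff\<close>). By the Tarski--Seidenberg theorem (\<open>semialg_projection\<close>) the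
  quantifiers can be removed, so that such a set of parameters is a Boolean combination of sets
  \<open>{\<epsilon>. f \<epsilon> > 0}\<close> with \<open>f\<close> a polynomial. The frontier of each of those consists of roots of \<open>f\<close>, or is
  empty if \<open>f = 0\<close>.

  The Tarski--Seidenberg theorem is proved along the lines of the Cohen--Hoermander procedure, but
  with sign tables replaced by order isomorphisms of the line: two lists of univariate polynomials have
  the same sign table iff some increasing bijection of the line matches their signs. If such a bijection
  matches the derivative of \<open>p\<close>, the other polynomials, and the results of one pseudo-division step of
  \<open>p\<close> by each of these, as well as the degrees and leading signs of all of them, then it matches
  the sign of \<open>p\<close> at all critical points and at all roots of the others; as \<open>p\<close> is
  monotone in between, the bijection can be corrected inside the gaps to match \<open>p\<close> everywhere
  (\<open>sgn_match_adjust\<close>, \<open>sign_match_step\<close>). Replacing a polynomial of maximal degree by polynomials of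
  smaller degree in this way ends with constants, that is, with functions of the parameters alone
  (\<open>sign_match_finite_test\<close>).
\<close>

section \<open>Signs of univariate polynomials under order isomorphisms of the line\<close>

lemma eventually_sgn_poly:
  fixes p :: "real poly"
  assumes "p \<noteq> 0"
  shows "eventually (\<lambda>x. sgn (poly p x) = sgn (lead_coeff p) * sgn x ^ degree p) at_infinity"
proof -
  let ?l = "lead_coeff p"
  have lim: "((\<lambda>x. poly p x / x ^ degree p) \<longlongrightarrow> ?l) at_infinity"
    by (rule poly_divide_tendsto_aux)
  have l: "?l \<noteq> 0" using assms by simp
  have "eventually (\<lambda>x. sgn (poly p x / x ^ degree p) = sgn ?l) at_infinity"
  proof (cases "?l > 0")
    case True
    show ?thesis
      using order_tendstoD(1)[OF lim True] by eventually_elim (use True in \<open>simp only: sgn_pos\<close>)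
  next
    case False
    then have neg: "?l < 0" using l by linarith
    show ?thesis
      using order_tendstoD(2)[OF lim neg] by eventually_elim (use neg in \<open>simp only: sgn_neg\<close>)
  qed
  moreover have "eventually (\<lambda>x::real. x \<noteq> 0) at_infinity"
    unfolding eventually_at_infinity by (intro exI[of _ 1]) auto
  ultimately show ?thesis
  proof eventually_elim
    case (elim x)
    have "sgn (poly p x) = sgn (poly p x / x ^ degree p * x ^ degree p)" using elim(2) by simp
    also have "\<dots> = sgn ?l * sgn x ^ degree p"
      by (simp only: sgn_mult elim(1) power_sgn)
    finally show ?case .
  qed
qed

lemma poly_strict_mono_between:
  fixes p :: "real poly"
  assumes "\<And>x. u < x \<Longrightarrow> x < v \<Longrightarrow> poly (pderiv p) x > 0" "u \<le> a" "a < b" "b \<le> v"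
  shows "poly p a < poly p b"
proof -
  obtain x where "a < x" "x < b" "poly p b - poly p a = (b - a) * poly (pderiv p) x"
    using poly_MVT[OF \<open>a < b\<close>] by blast
  moreover from this have "poly (pderiv p) x > 0" using assms by auto
  ultimately have "poly p b - poly p a > 0" using \<open>a < b\<close> by simp
  then show ?thesis by simp
qed

lemma poly_sgn_constant_between:
  fixes p :: "real poly"
  assumes "\<And>x. u < x \<Longrightarrow> x < v \<Longrightarrow> poly p x \<noteq> 0" "u < a" "a < v" "u < b" "b < v"
  shows "sgn (poly p a) = sgn (poly p b)"
proof -
  have *: "sgn (poly p a) = sgn (poly p b)" if ab: "a < b" "u < a" "b < v" for a b
  proof (rule ccontr)
    assume "sgn (poly p a) \<noteq> sgn (poly p b)"
    moreover have "poly p a \<noteq> 0" "poly p b \<noteq> 0" using assms(1) ab by auto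
    ultimately have "poly p a * poly p b < 0"
      by (auto simp: sgn_if mult_less_0_iff split: if_splits)
    then obtain x where "x > a" "x < b" "poly p x = 0" using poly_IVT[OF ab(1)] by blast
    then show False using assms(1) ab by force
  qed
  show ?thesis using *[of a b] *[of b a] assms(2-) by (metis linorder_neqE)
qed

definition order_iso :: "(real \<Rightarrow> real) \<Rightarrow> bool" where
  "order_iso \<phi> \<longleftrightarrow> strict_mono \<phi> \<and> surj \<phi>"

lemma order_iso_less_iff: "order_iso \<phi> \<Longrightarrow> \<phi> x < \<phi> y \<longleftrightarrow> x < y"
  by (simp add: order_iso_def strict_mono_less)

lemma order_iso_compose: "order_iso \<phi> \<Longrightarrow> order_iso \<rho> \<Longrightarrow> order_iso (\<rho> \<circ> \<phi>)"
  unfolding order_iso_def strict_mono_def using comp_surj[of \<phi> \<rho>] by simp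

lemma order_iso_at_infinity:
  assumes "order_iso \<phi>"
  shows "filterlim \<phi> at_top at_top" "filterlim \<phi> at_bot at_bot"
proof -
  have m: "mono \<phi>" and s: "surj \<phi>" using assms by (auto simp: order_iso_def strict_mono_mono)
  show "filterlim \<phi> at_top at_top"
    unfolding filterlim_at_top
  proof
    fix Z obtain z where "\<phi> z = Z" using s by (metis surjD)
    with m have *: "\<And>x. z \<le> x \<Longrightarrow> Z \<le> \<phi> x" "\<And>x. x \<le> z \<Longrightarrow> \<phi> x \<le> Z" by (auto dest: monoD)
    show "eventually (\<lambda>x. Z \<le> \<phi> x) at_top"
      using eventually_ge_at_top[of z] by eventually_elim (rule *(1))
  qed
  show "filterlim \<phi> at_bot at_bot"
    unfolding filterlim_at_bot
  proof
    fix Z obtain z where "\<phi> z = Z" using s by (metis surjD)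
    with m have *: "\<And>x. z \<le> x \<Longrightarrow> Z \<le> \<phi> x" "\<And>x. x \<le> z \<Longrightarrow> \<phi> x \<le> Z" by (auto dest: monoD)
    show "eventually (\<lambda>x. \<phi> x \<le> Z) at_bot"
      using eventually_le_at_bot[of z] by eventually_elim (rule *(2))
  qed
qed

text \<open>
  Fixing everything outside \<open>(a, b)\<close> lets one correction be made per gap between special points
  without disturbing the corrections already made elsewhere. The map is piecewise linear with
  break points \<open>a\<close>, \<open>s\<close>, \<open>b\<close>; its inverse is the same construction with \<open>s\<close> and \<open>t\<close> exchanged.
\<close>

lemma order_iso_move_point:
  assumes "a < s" "s < b" "a < t" "t < b"
  obtains \<rho> where "order_iso \<rho>" "\<rho> s = t" "\<And>x. x \<le> a \<or> b \<le> x \<Longrightarrow> \<rho> x = x"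
proof -
  define g where "g s t x = (if x \<le> a \<or> b \<le> x then x else if x \<le> s
     then a + (x - a) * ((t - a) / (s - a)) else b - (b - x) * ((b - t) / (b - s)))" for s t x :: real
  have inverse: "g t s (g s t x) = x" if st: "a < s" "s < b" "a < t" "t < b" for s t x
  proof -
    consider "x \<le> a \<or> b \<le> x" | "a < x" "x \<le> s" | "s < x" "x < b" by linarith
    then show ?thesis
    proof cases
      case 1 then show ?thesis by (auto simp: g_def)
    next
      case 2
      define y where "y = (x - a) * ((t - a) / (s - a))"
      have "y \<le> (s - a) * ((t - a) / (s - a))"
        unfolding y_def by (rule mult_right_mono) (use 2 st in auto)
      also have "\<dots> = t - a" using st by simp
      finally have "y \<le> t - a" .
      moreover have "y > 0" using 2 st by (simp add: y_def)
      moreover have "y * ((s - a) / (t - a)) = x - a" using st by (simp add: y_def)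
      moreover have "g s t x = a + y" using 2 st by (simp add: g_def y_def)
      ultimately show ?thesis using st by (simp add: g_def)
    next
      case 3
      define y where "y = (b - x) * ((b - t) / (b - s))"
      have "y < (b - s) * ((b - t) / (b - s))"
        unfolding y_def by (rule mult_strict_right_mono) (use 3 st in auto)
      also have "\<dots> = b - t" using st by simp
      finally have "y < b - t" .
      moreover have "y > 0" using 3 st by (simp add: y_def)
      moreover have "y * ((b - s) / (b - t)) = b - x" using st by (simp add: y_def)
      moreover have "g s t x = b - y" using 3 st by (simp add: g_def y_def)
      ultimately show ?thesis using st by (simp add: g_def)
    qed
  qed
  have mono: "g s t x \<le> g s t y" if "x < y" for x y
  proof -
    have range: "a < g s t x \<and> g s t x \<le> t" if "a < x" "x \<le> s" for x
    proof -
      have "(x - a) * ((t - a) / (s - a)) \<le> (s - a) * ((t - a) / (s - a))"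
        by (rule mult_right_mono) (use that assms in auto)
      also have "\<dots> = t - a" using assms by simp
      finally show ?thesis using that assms by (simp add: g_def)
    qed
    have range': "t \<le> g s t x \<and> g s t x < b" if "s < x" "x < b" for x
    proof -
      have "(b - x) * ((b - t) / (b - s)) \<le> (b - s) * ((b - t) / (b - s))"
        by (rule mult_right_mono) (use that assms in auto)
      also have "\<dots> = b - t" using assms by simp
      finally show ?thesis using that assms by (simp add: g_def)
    qed
    have left: "g s t x \<le> g s t y" if "a < x" "y \<le> s"
    proof -
      have "(x - a) * ((t - a) / (s - a)) \<le> (y - a) * ((t - a) / (s - a))"
        by (rule mult_right_mono) (use that \<open>x < y\<close> assms in auto)
      then show ?thesis using that \<open>x < y\<close> assms by (simp add: g_def)
    qed
    have right: "g s t x \<le> g s t y" if "s < x" "y < b"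
    proof -
      have "(b - y) * ((b - t) / (b - s)) \<le> (b - x) * ((b - t) / (b - s))"
        by (rule mult_right_mono) (use that \<open>x < y\<close> assms in auto)
      then show ?thesis using that \<open>x < y\<close> assms by (simp add: g_def)
    qed
    have fix_: "g s t z = z" if "z \<le> a \<or> b \<le> z" for z using that by (auto simp: g_def)
    consider "x \<le> a \<or> b \<le> y" | "a < x" "y \<le> s" | "s < x" "y < b" | "a < x" "x \<le> s" "s < y" "y < b"
      using that by linarith
    then show ?thesis
    proof cases
      case 1
      then have "x \<le> g s t y \<and> x \<le> a \<or> g s t x \<le> y \<and> b \<le> y"
        using range[of x] range[of y] range'[of x] range'[of y] fix_[of x] fix_[of y] \<open>x < y\<close> assms by linarith
      then show ?thesis using fix_[of x] fix_[of y] by auto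
    next
      case 2 then show ?thesis by (rule left)
    next
      case 3 then show ?thesis by (rule right)
    next
      case 4 then show ?thesis using range[of x] range'[of y] by linarith
    qed
  qed
  have inj: "inj (g s t)" using inverse[OF assms] by (metis injI)
  have "order_iso (g s t)"
    unfolding order_iso_def
  proof
    show "strict_mono (g s t)"
      using mono inj by (metis injD less_le strict_monoI)
    show "surj (g s t)"
      using inverse[of t s] assms by (metis surjI)
  qed
  moreover have "g s t s = t" using assms by (simp add: g_def)
  moreover have "g s t x = x" if "x \<le> a \<or> b \<le> x" for x using that by (auto simp: g_def)
  ultimately show ?thesis by (rule that)
qed

lemma finite_neighbours:
  fixes S :: "real set"
  assumes "finite S" "lo \<in> S" "hi \<in> S" "lo < x" "x < hi" "x \<notin> S"
  obtains u v where "u \<in> S" "v \<in> S" "u < x" "x < v" "\<And>t. u < t \<Longrightarrow> t < v \<Longrightarrow> t \<notin> S"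
proof -
  let ?L = "{s \<in> S. s < x}" and ?R = "{s \<in> S. x < s}"
  have L: "finite ?L" "?L \<noteq> {}" and R: "finite ?R" "?R \<noteq> {}" using assms by auto
  have "t \<notin> S" if "Max ?L < t" "t < Min ?R" for t
  proof
    assume "t \<in> S"
    then have "t \<in> ?L \<or> t \<in> ?R" using assms(6) by (cases t x rule: linorder_cases) auto
    then show False using Max_ge[OF L(1)] Min_le[OF R(1)] that by force
  qed
  moreover have "Max ?L \<in> ?L" "Min ?R \<in> ?R" using Max_in[OF L] Min_in[OF R] .
  ultimately show ?thesis using that[of "Max ?L" "Min ?R"] by (metis (lifting) mem_Collect_eq)
qed

text \<open>
  On an interval where \<open>p\<close> increases, an interior root is witnessed by the signs of \<open>p\<close> at the two
  ends, and those signs are shared with \<open>q\<close>.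
\<close>

lemma root_between_transfer:
  fixes p q :: "real poly"
  assumes \<phi>: "order_iso \<phi>" and "u < v"
    and sgn_ends: "sgn (poly p u) = sgn (poly q (\<phi> u))" "sgn (poly p v) = sgn (poly q (\<phi> v))"
    and mono: "\<And>x. u < x \<Longrightarrow> x < v \<Longrightarrow> poly (pderiv p) x > 0"
    and r: "u < r" "r < v" "poly p r = 0"
  shows "\<exists>r'. \<phi> u < r' \<and> r' < \<phi> v \<and> poly q r' = 0"
proof -
  have "poly p u < 0" "poly p v > 0"
    using poly_strict_mono_between[OF mono, of u v u r] poly_strict_mono_between[OF mono, of u v r v] r by auto
  then have "poly q (\<phi> u) < 0" "poly q (\<phi> v) > 0"
    using sgn_ends by (auto simp: sgn_if split: if_splits)
  then show ?thesis using poly_IVT_pos[of "\<phi> u" "\<phi> v" q] \<open>u < v\<close> order_iso_less_iff[OF \<phi>] by blast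
qed

text \<open>
  Either the end signs already decide the sign of both increasing functions inside the interval, or
  both change sign there; in that case the sign depends only on the position relative to the root,
  and \<open>\<phi>\<close> matches the two roots.
\<close>

lemma sgn_between_transfer:
  fixes p q :: "real poly"
  assumes \<phi>: "order_iso \<phi>" and x: "u < x" "x < v"
    and sgn_ends: "sgn (poly p u) = sgn (poly q (\<phi> u))" "sgn (poly p v) = sgn (poly q (\<phi> v))"
    and mono: "\<And>x. u < x \<Longrightarrow> x < v \<Longrightarrow> poly (pderiv p) x > 0"
    and mono': "\<And>x. \<phi> u < x \<Longrightarrow> x < \<phi> v \<Longrightarrow> poly (pderiv q) x > 0"
    and roots: "\<And>r. u < r \<Longrightarrow> r < v \<Longrightarrow> poly p r = 0 \<Longrightarrow> poly q (\<phi> r) = 0"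
  shows "sgn (poly p x) = sgn (poly q (\<phi> x))"
proof -
  note [simp] = order_iso_less_iff[OF \<phi>]
  have p: "poly p a < poly p b" if "u \<le> a" "a < b" "b \<le> v" for a b
    using poly_strict_mono_between[OF mono] that by blast
  have q: "poly q (\<phi> a) < poly q (\<phi> b)" if "u \<le> a" "a < b" "b \<le> v" for a b
  proof -
    have "\<phi> u \<le> \<phi> a" "\<phi> a < \<phi> b" "\<phi> b \<le> \<phi> v" using that by (simp_all add: not_less[symmetric])
    then show ?thesis using poly_strict_mono_between[OF mono'] by blast
  qed
  consider "poly p u \<ge> 0" | "poly p v \<le> 0" | "poly p u < 0" "poly p v > 0" by linarith
  then show ?thesis
  proof cases
    case 1
    then have "poly q (\<phi> u) \<ge> 0" using sgn_ends by (auto simp: sgn_if split: if_splits)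
    then show ?thesis using 1 p[of u x] q[of u x] x by simp
  next
    case 2
    then have "poly q (\<phi> v) \<le> 0" using sgn_ends by (auto simp: sgn_if split: if_splits)
    then show ?thesis using 2 p[of x v] q[of x v] x by simp
  next
    case 3
    then obtain r where r: "u < r" "r < v" "poly p r = 0"
      using poly_IVT_pos[of u v p] x by auto
    then have "poly q (\<phi> r) = 0" using roots by blast
    then show ?thesis
      using p[of r x] p[of x r] q[of r x] q[of x r] x r by (cases x r rule: linorder_cases) auto
  qed
qed

text \<open>
  The heart of the elimination. Suppose \<open>\<phi>\<close> matches the signs of \<open>p\<close> and \<open>q\<close> on a finite set \<open>S\<close>
  outside which it matches the nonzero signs of their derivatives. Between consecutive points of \<open>S\<close>
  both polynomials are strictly monotone in the same direction, so their roots in corresponding gaps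
  correspond. It remains to move, gap by gap, the image of each root of \<open>p\<close> to the root of \<open>q\<close>. Because
  the new map agrees with \<open>\<phi>\<close> on \<open>S\<close>, signs that only change at points of \<open>S\<close> stay matched. The points
  \<open>lo\<close> and \<open>hi\<close> bound the region where roots can occur, so that every gap to be treated is a bounded
  interval.
\<close>

lemma sgn_match_adjust:
  fixes p q :: "real poly"
  assumes \<phi>: "order_iso \<phi>" and S: "finite S" "lo \<in> S" "hi \<in> S"
    and sgn_S: "\<And>s. s \<in> S \<Longrightarrow> sgn (poly p s) = sgn (poly q (\<phi> s))"
    and deriv: "\<And>x. x \<notin> S \<Longrightarrow> poly (pderiv p) x \<noteq> 0"
      "\<And>x. x \<notin> S \<Longrightarrow> sgn (poly (pderiv p) x) = sgn (poly (pderiv q) (\<phi> x))"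
    and outside: "\<And>x y. x \<le> lo \<Longrightarrow> y \<le> lo \<Longrightarrow> sgn (poly p x) = sgn (poly q (\<phi> y)) \<and> poly p x \<noteq> 0"
      "\<And>x y. x \<ge> hi \<Longrightarrow> y \<ge> hi \<Longrightarrow> sgn (poly p x) = sgn (poly q (\<phi> y)) \<and> poly p x \<noteq> 0"
  shows "\<exists>\<phi>'. order_iso \<phi>' \<and> (\<forall>s\<in>S. \<phi>' s = \<phi> s) \<and> (\<forall>x. sgn (poly p x) = sgn (poly q (\<phi>' x)))"
proof -
  have gap: "\<exists>u v \<delta>. u \<in> S \<and> v \<in> S \<and> u < x \<and> x < v \<and> (\<forall>t. u < t \<longrightarrow> t < v \<longrightarrow> t \<notin> S) \<and>
      (\<forall>t. u < t \<longrightarrow> t < v \<longrightarrow> poly (pderiv (smult \<delta> p)) t > 0) \<and>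
      (\<forall>t. \<phi> u < t \<longrightarrow> t < \<phi> v \<longrightarrow> poly (pderiv (smult \<delta> q)) t > 0) \<and> \<delta> \<noteq> 0"
    if x: "lo < x" "x < hi" "x \<notin> S" for x
  proof -
    obtain u v where uv: "u \<in> S" "v \<in> S" "u < x" "x < v" "\<And>t. u < t \<Longrightarrow> t < v \<Longrightarrow> t \<notin> S"
      using finite_neighbours[OF S x] by blast
    \<comment> \<open>Multiplying both polynomials by the sign of the derivative reduces to the increasing case.\<close>
    define \<delta> where "\<delta> = sgn (poly (pderiv p) x)"
    have \<delta>: "\<delta> \<noteq> 0" using deriv(1)[OF x(3)] by (simp add: \<delta>_def sgn_zero_iff)
    have sgn_p: "sgn (poly (pderiv p) t) = \<delta>" if "u < t" "t < v" for t
      unfolding \<delta>_def using poly_sgn_constant_between[of u v "pderiv p" t x] deriv(1) uv that by blast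
    have pos: "\<delta> * z > 0" if "sgn z = \<delta>" for z
      using that \<delta> by (auto simp: sgn_if zero_less_mult_iff split: if_splits)
    have "poly (pderiv (smult \<delta> q)) t > 0" if t: "\<phi> u < t" "t < \<phi> v" for t
    proof -
      obtain t' where t': "t = \<phi> t'" using \<phi> by (metis order_iso_def surjD)
      then have "u < t'" "t' < v" using t order_iso_less_iff[OF \<phi>] by auto
      then show ?thesis using deriv(2)[of t'] uv(5)[of t'] sgn_p[of t'] pos
        by (simp add: pderiv_smult t')
    qed
    then show ?thesis using uv sgn_p pos \<delta>
      by (intro exI[of _ u] exI[of _ v] exI[of _ \<delta>]) (auto simp: pderiv_smult)
  qed
  have sgn_smult: "sgn (poly (smult \<delta> p) s) = sgn (poly (smult \<delta> q) (\<phi> s))" if "s \<in> S" for \<delta> s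
    using sgn_S[OF that] by (simp add: sgn_mult)
  \<comment> \<open>Correct the images of the roots one at a time.\<close>
  have adjust: "\<exists>\<phi>'. order_iso \<phi>' \<and> (\<forall>s\<in>S. \<phi>' s = \<phi> s) \<and> (\<forall>r\<in>M. poly q (\<phi>' r) = 0)"
    if "finite M" "M \<subseteq> {r. poly p r = 0 \<and> r \<notin> S}" for M
    using that
  proof (induction M rule: finite_induct)
    case empty
    then show ?case using \<phi> by blast
  next
    case (insert r M)
    then obtain \<phi>' where \<phi>': "order_iso \<phi>'" "\<And>s. s \<in> S \<Longrightarrow> \<phi>' s = \<phi> s"
        "\<And>r. r \<in> M \<Longrightarrow> poly q (\<phi>' r) = 0" by blast
    have r: "poly p r = 0" "r \<notin> S" using insert.prems by auto
    have "lo < r" "r < hi" using outside(1)[of r r] outside(2)[of r r] r by force+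
    then obtain u v \<delta> where uv: "u \<in> S" "v \<in> S" "u < r" "r < v" "\<And>t. u < t \<Longrightarrow> t < v \<Longrightarrow> t \<notin> S"
      "\<And>t. u < t \<Longrightarrow> t < v \<Longrightarrow> poly (pderiv (smult \<delta> p)) t > 0" and \<delta>: "\<delta> \<noteq> 0"
      using gap[of r] r by blast
    obtain r' where r': "\<phi> u < r'" "r' < \<phi> v" "poly q r' = 0"
      using root_between_transfer[OF \<phi> _ sgn_smult[OF uv(1)] sgn_smult[OF uv(2)] uv(6) uv(3,4)] uv(3,4) r \<delta> by auto
    have "\<phi> u < \<phi>' r" "\<phi>' r < \<phi> v"
      using \<phi>'(2)[OF uv(1)] \<phi>'(2)[OF uv(2)] uv(3,4) order_iso_less_iff[OF \<phi>'(1)] by metis+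
    then obtain \<rho> where \<rho>: "order_iso \<rho>" "\<rho> (\<phi>' r) = r'" "\<And>x. x \<le> \<phi> u \<or> \<phi> v \<le> x \<Longrightarrow> \<rho> x = x"
      using order_iso_move_point[of "\<phi> u" "\<phi>' r" "\<phi> v" r'] r' by metis
    have fixed: "\<rho> (\<phi>' t) = \<phi>' t" if "t \<le> u \<or> v \<le> t" for t
    proof -
      have "\<phi>' t \<le> \<phi>' u \<or> \<phi>' v \<le> \<phi>' t" using that \<phi>'(1) by (auto simp: order_iso_def strict_mono_less_eq)
      then show ?thesis using \<rho>(3) \<phi>'(2) uv(1,2) by simp
    qed
    have "\<rho> (\<phi>' s) = \<phi> s" if "s \<in> S" for s
      using fixed[of s] uv(5)[of s] that \<phi>'(2) by force
    moreover have "poly q (\<rho> (\<phi>' m)) = 0" if "m \<in> M" for m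
    proof -
      \<comment> \<open>Roots handled earlier lie outside the gap \<open>(u, v)\<close>: monotonicity allows only one root in it.\<close>
      have "m \<le> u \<or> v \<le> m"
      proof (rule ccontr)
        assume "\<not> (m \<le> u \<or> v \<le> m)"
        then have m: "u < m" "m < v" by auto
        have "poly p m = 0" "m \<noteq> r" using insert that by auto
        then show False
          using poly_strict_mono_between[OF uv(6), of u v m r] poly_strict_mono_between[OF uv(6), of u v r m] m uv(3,4) r
          by (cases m r rule: linorder_cases) auto
      qed
      then show ?thesis using fixed \<phi>'(3)[OF that] by simp
    qed
    ultimately show ?case
      using order_iso_compose[OF \<phi>'(1) \<rho>(1)] \<rho>(2) r'(3) by (intro exI[of _ "\<rho> \<circ> \<phi>'"]) (auto simp: o_def)
  qed
  have "p \<noteq> 0" using outside(1)[of lo lo] by auto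
  then have "finite {r. poly p r = 0 \<and> r \<notin> S}" by (simp add: poly_roots_finite)
  then obtain \<phi>' where \<phi>': "order_iso \<phi>'" "\<And>s. s \<in> S \<Longrightarrow> \<phi>' s = \<phi> s"
      "\<And>r. poly p r = 0 \<Longrightarrow> r \<notin> S \<Longrightarrow> poly q (\<phi>' r) = 0"
    using adjust[OF _ order_refl] by auto
  have "sgn (poly p x) = sgn (poly q (\<phi>' x))" for x
  proof -
    have le: "\<phi>' a \<le> \<phi>' b \<longleftrightarrow> a \<le> b" for a b
      using \<phi>'(1) by (simp add: order_iso_def strict_mono_less_eq)
    \<comment> \<open>\<open>y\<close> is the point that \<open>\<phi>\<close> sends to \<open>\<phi>' x\<close>; it lies in the same gap of \<open>S\<close> as \<open>x\<close>. For \<open>x\<close> beyond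
       \<open>lo\<close> or \<open>hi\<close> the sign of \<open>p\<close> at \<open>x\<close> is compared with that of \<open>q\<close> at \<open>\<phi> y\<close>.\<close>
    obtain y where y: "\<phi>' x = \<phi> y" using \<phi> by (metis order_iso_def surjD)
    have cmp: "y \<le> s \<longleftrightarrow> x \<le> s" "s \<le> y \<longleftrightarrow> s \<le> x" if "s \<in> S" for s
      using le[of x s] le[of s x] \<phi>'(2)[OF that] y \<phi> by (auto simp: order_iso_def strict_mono_less_eq)
    consider "x \<in> S" | "x \<le> lo" | "hi \<le> x" | "x \<notin> S" "lo < x" "x < hi" by linarith
    then show ?thesis
    proof cases
      case 1 then show ?thesis using sgn_S \<phi>'(2) by simp
    next
      case 2 then show ?thesis using outside(1)[of x y] cmp(1)[OF S(2)] y by simp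
    next
      case 3 then show ?thesis using outside(2)[of x y] cmp(2)[OF S(3)] y by simp
    next
      case 4
      then obtain u v \<delta> where uv: "u \<in> S" "v \<in> S" "u < x" "x < v" "\<And>t. u < t \<Longrightarrow> t < v \<Longrightarrow> t \<notin> S"
        "\<And>t. u < t \<Longrightarrow> t < v \<Longrightarrow> poly (pderiv (smult \<delta> p)) t > 0"
        "\<And>t. \<phi> u < t \<Longrightarrow> t < \<phi> v \<Longrightarrow> poly (pderiv (smult \<delta> q)) t > 0" and \<delta>: "\<delta> \<noteq> 0"
        using gap[OF 4(2,3,1)] by blast
      have "sgn (poly (smult \<delta> p) x) = sgn (poly (smult \<delta> q) (\<phi>' x))"
      proof (rule sgn_between_transfer[OF \<phi>'(1) uv(3,4)])
        show "sgn (poly (smult \<delta> p) u) = sgn (poly (smult \<delta> q) (\<phi>' u))"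
          using sgn_smult[OF uv(1)] \<phi>'(2)[OF uv(1)] by simp
        show "sgn (poly (smult \<delta> p) v) = sgn (poly (smult \<delta> q) (\<phi>' v))"
          using sgn_smult[OF uv(2)] \<phi>'(2)[OF uv(2)] by simp
        show "poly (pderiv (smult \<delta> p)) t > 0" if "u < t" "t < v" for t
          using uv(6) that .
        show "poly (pderiv (smult \<delta> q)) t > 0" if "\<phi>' u < t" "t < \<phi>' v" for t
          using uv(7) that \<phi>'(2)[OF uv(1)] \<phi>'(2)[OF uv(2)] by simp
        show "poly (smult \<delta> q) (\<phi>' r) = 0" if "u < r" "r < v" "poly (smult \<delta> p) r = 0" for r
          using \<phi>'(3)[of r] uv(5)[of r] that \<delta> by simp
      qed
      then show ?thesis using \<delta> by (simp add: sgn_mult sgn_zero_iff)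
    qed
  qed
  then show ?thesis using \<phi>' by blast
qed

text \<open>
  Near \<open>\<plusminus>\<infinity>\<close> the sign of a polynomial is determined by its degree and the sign of its leading
  coefficient, and \<open>\<phi>\<close> preserves neighbourhoods of both ends.
\<close>

lemma common_sgn_at_ends:
  fixes p q :: "real poly"
  assumes \<phi>: "order_iso \<phi>" and "p \<noteq> 0" "degree p = degree q" "sgn (lead_coeff p) = sgn (lead_coeff q)"
  obtains lo hi where
    "\<And>x y. x \<le> lo \<Longrightarrow> y \<le> lo \<Longrightarrow> sgn (poly p x) = sgn (poly q (\<phi> y)) \<and> poly p x \<noteq> 0"
    "\<And>x y. x \<ge> hi \<Longrightarrow> y \<ge> hi \<Longrightarrow> sgn (poly p x) = sgn (poly q (\<phi> y)) \<and> poly p x \<noteq> 0"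
proof -
  let ?t = "sgn (lead_coeff p)" and ?b = "sgn (lead_coeff p) * (-1) ^ degree p"
  have nz: "?t \<noteq> 0" "?b \<noteq> 0" using assms(2) by (auto simp: sgn_zero_iff)
  have ends: "eventually (\<lambda>x. sgn (poly r x) = ?t) at_top" "eventually (\<lambda>x. sgn (poly r x) = ?b) at_bot"
    if "r \<noteq> 0" "degree r = degree p" "sgn (lead_coeff r) = ?t" for r :: "real poly"
  proof -
    have *: "eventually (\<lambda>x. sgn (poly r x) = ?t * sgn x ^ degree p) at_top"
      "eventually (\<lambda>x. sgn (poly r x) = ?t * sgn x ^ degree p) at_bot"
      using eventually_sgn_poly[OF that(1)] that by (simp_all add: at_infinity_eq_at_top_bot eventually_sup)
    show "eventually (\<lambda>x. sgn (poly r x) = ?t) at_top"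
      using *(1) eventually_gt_at_top[of 0] by eventually_elim simp
    show "eventually (\<lambda>x. sgn (poly r x) = ?b) at_bot"
      using *(2) eventually_gt_at_bot[of 0] by eventually_elim simp
  qed
  have "q \<noteq> 0" using nz(1) assms(4) by auto
  note p = ends[OF assms(2)] and q = ends[OF this]
  have "eventually (\<lambda>x. sgn (poly p x) = ?t \<and> sgn (poly q (\<phi> x)) = ?t) at_top"
    using p(1) filterlim_iff[THEN iffD1, OF order_iso_at_infinity(1)[OF \<phi>], rule_format, OF q(1)] assms
    by (auto intro: eventually_conj)
  then obtain hi where hi: "\<And>x. x \<ge> hi \<Longrightarrow> sgn (poly p x) = ?t \<and> sgn (poly q (\<phi> x)) = ?t"
    unfolding eventually_at_top_linorder by blast
  have "eventually (\<lambda>x. sgn (poly p x) = ?b \<and> sgn (poly q (\<phi> x)) = ?b) at_bot"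
    using p(2) filterlim_iff[THEN iffD1, OF order_iso_at_infinity(2)[OF \<phi>], rule_format, OF q(2)] assms
    by (auto intro: eventually_conj)
  then obtain lo where lo: "\<And>x. x \<le> lo \<Longrightarrow> sgn (poly p x) = ?b \<and> sgn (poly q (\<phi> x)) = ?b"
    unfolding eventually_at_bot_linorder by blast
  have "sgn (poly p x) = sgn (poly q (\<phi> y)) \<and> poly p x \<noteq> 0" if "x \<le> lo" "y \<le> lo" for x y
    using lo[OF that(1)] lo[OF that(2)] nz(2) by (metis sgn_zero)
  moreover have "sgn (poly p x) = sgn (poly q (\<phi> y)) \<and> poly p x \<noteq> 0" if "x \<ge> hi" "y \<ge> hi" for x y
    using hi[OF that(1)] hi[OF that(2)] nz(1) by (metis sgn_zero)
  ultimately show ?thesis by (rule that)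
qed

section \<open>Sign tables of parametric polynomials\<close>

text \<open>
  For \<open>e = degree g \<le> D\<close> and \<open>degree p \<le> D\<close> this is one step of pseudo-division of \<open>p\<close> by \<open>g\<close>: the terms
  of degree \<open>D\<close> cancel, and the cutoff does nothing. For other values of \<open>e\<close> the cutoff merely forces the
  degree below \<open>D\<close>, so that one may include a candidate for every possible degree of \<open>g\<close> without
  knowing the actual one. Squaring the leading coefficient of \<open>g\<close> keeps the sign of \<open>p\<close> at the roots of
  \<open>g\<close>.
\<close>

definition lead_cancel :: "nat \<Rightarrow> nat \<Rightarrow> real poly \<Rightarrow> real poly \<Rightarrow> real poly" where
  "lead_cancel D e p g = poly_cutoff D
     (smult ((coeff g e)\<^sup>2) p - smult (coeff g e * coeff p D) (monom 1 (D - e) * g))"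

lemma poly_cutoff_eq_self: "(\<And>i. i \<ge> D \<Longrightarrow> coeff p i = 0) \<Longrightarrow> poly_cutoff D p = p"
  by (rule poly_eqI) (simp add: coeff_poly_cutoff)

lemma poly_lead_cancel_at_root:
  assumes "degree p \<le> D" "degree g = e" "e \<le> D" "poly g x = 0"
  shows "poly (lead_cancel D e p g) x = (coeff g e)\<^sup>2 * poly p x"
proof -
  have "lead_cancel D e p g = smult ((coeff g e)\<^sup>2) p - smult (coeff g e * coeff p D) (monom 1 (D - e) * g)"
    unfolding lead_cancel_def
  proof (rule poly_cutoff_eq_self)
    fix i assume "D \<le> i"
    show "coeff (smult ((coeff g e)\<^sup>2) p - smult (coeff g e * coeff p D) (monom 1 (D - e) * g)) i = 0"
    proof (cases "i = D")
      case True
      then show ?thesis using assms by (simp add: coeff_monom_mult power2_eq_square)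
    next
      case False
      then have "coeff p i = 0" "coeff g (i - (D - e)) = 0" "\<not> i < D - e"
        using assms \<open>D \<le> i\<close> by (auto intro!: coeff_eq_0)
      then show ?thesis by (simp add: coeff_monom_mult)
    qed
  qed
  then show ?thesis using assms by simp
qed

lemma degree_eq_of_sgn_coeff:
  fixes p q :: "real poly"
  assumes "degree p \<le> D" "degree q \<le> D" "\<And>e. e \<le> D \<Longrightarrow> sgn (coeff p e) = sgn (coeff q e)"
  shows "degree p = degree q" "p = 0 \<longleftrightarrow> q = 0" "sgn (lead_coeff p) = sgn (lead_coeff q)"
proof -
  have zero: "coeff p e = 0 \<longleftrightarrow> coeff q e = 0" for e
    using assms(3)[of e] assms(1,2) coeff_eq_0[of p e] coeff_eq_0[of q e]
    by (cases "e \<le> D") (metis sgn_zero_iff, simp)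
  then show *: "degree p = degree q" by (simp add: degree_def)
  show "p = 0 \<longleftrightarrow> q = 0" using zero by (simp add: poly_eq_iff)
  show "sgn (lead_coeff p) = sgn (lead_coeff q)" using * assms(1,3) by simp
qed

text \<open>
  Two lists of polynomials have the same sign table iff a monotone reparametrization of the line carries
  the signs of one to those of the other. Quantifying over the reparametrization avoids encoding the
  roots and the intervals between them.
\<close>

definition sign_match :: "('y \<Rightarrow> real poly) set \<Rightarrow> 'y \<Rightarrow> 'y \<Rightarrow> bool" where
  "sign_match L y y' \<longleftrightarrow>
     (\<exists>\<phi>. order_iso \<phi> \<and> (\<forall>F\<in>L. \<forall>x. sgn (poly (F y) x) = sgn (poly (F y') (\<phi> x))))"

text \<open>
  Matching these families together with \<open>L\<close> forces \<open>F\<close> to match: the derivative gives monotonicity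
  between special points, the cancelled polynomials give the sign of \<open>F\<close> at the roots of the others,
  the constant polynomials give degrees and signs of leading coefficients, and the cutoff covers the
  parameters where the formal leading coefficient of \<open>F\<close> vanishes. If the degrees of \<open>F\<close> and \<open>L\<close> are
  at most \<open>D\<close> and \<open>D\<close> is positive, all of them have degree below \<open>D\<close>, which makes an induction
  possible.
\<close>

definition auxiliary_families :: "nat \<Rightarrow> ('y \<Rightarrow> real poly) \<Rightarrow> ('y \<Rightarrow> real poly) set \<Rightarrow> ('y \<Rightarrow> real poly) set" where
  "auxiliary_families D F L =
     (let F' = (\<lambda>y. pderiv (F y)) in
       {F', (\<lambda>y. poly_cutoff D (F y))} \<union>
       (\<lambda>(G, e) y. lead_cancel D e (F y) (G y)) ` (insert F' L \<times> {..D}) \<union>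
       (\<lambda>(G, e) y. [:coeff (G y) e:]) ` (insert F (insert F' L) \<times> {..D}))"

text \<open>
  The special points are the roots of the nonzero members of \<open>L\<close> and of the derivative of \<open>F\<close>. At
  them the sign of \<open>F\<close> is that of a cancelled polynomial, and elsewhere the derivative does not vanish,
  so \<open>sgn_match_adjust\<close> applies. Members of \<open>L\<close> remain matched because the new map
  stays in the same gap of the special points, where they keep their sign.
\<close>

lemma sign_match_step:
  assumes L: "finite L" and D: "D \<ge> 1"
    and deg: "\<And>G z. G \<in> insert F L \<Longrightarrow> degree (G z) \<le> D"
    and match: "sign_match (L \<union> auxiliary_families D F L) y y'"
  shows "sign_match (insert F L) y y'"
proof -
  define F' where "F' = (\<lambda>y. pderiv (F y))"
  let ?N = "insert F' L"
  obtain \<phi> where \<phi>: "order_iso \<phi>"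
    and sgn_aux: "\<And>G x. G \<in> L \<union> auxiliary_families D F L \<Longrightarrow> sgn (poly (G y) x) = sgn (poly (G y') (\<phi> x))"
    using match unfolding sign_match_def by blast
  have sgn_cutoff: "sgn (poly (poly_cutoff D (F y)) x) = sgn (poly (poly_cutoff D (F y')) (\<phi> x))" for x
    using sgn_aux[of "\<lambda>y. poly_cutoff D (F y)" x] by (simp add: auxiliary_families_def Let_def)
  have sgn_N: "sgn (poly (G y) x) = sgn (poly (G y') (\<phi> x))" if "G \<in> ?N" for G x
    using sgn_aux[of G x] that by (auto simp: auxiliary_families_def Let_def F'_def)
  have sgn_cancel: "sgn (poly (lead_cancel D e (F y) (G y)) x) = sgn (poly (lead_cancel D e (F y') (G y')) (\<phi> x))"
    if "G \<in> ?N" "e \<le> D" for G e x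
  proof -
    have "(\<lambda>y. lead_cancel D e (F y) (G y)) \<in> auxiliary_families D F L"
      unfolding auxiliary_families_def Let_def
      by (intro UnI1 UnI2 image_eqI[of _ _ "(G, e)"]) (use that in \<open>auto simp: F'_def\<close>)
    then show ?thesis using sgn_aux by blast
  qed
  have sgn_coeff: "sgn (coeff (G y) e) = sgn (coeff (G y') e)" if "G \<in> insert F ?N" "e \<le> D" for G e
  proof -
    have "(\<lambda>y. [:coeff (G y) e:]) \<in> auxiliary_families D F L"
      unfolding auxiliary_families_def Let_def
      by (intro UnI2 image_eqI[of _ _ "(G, e)"]) (use that in \<open>auto simp: F'_def\<close>)
    then show ?thesis using sgn_aux[of "\<lambda>y. [:coeff (G y) e:]" 0] by simp
  qed
  have deg': "degree (G z) \<le> D" if "G \<in> insert F ?N" for G z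
    using deg[of G z] deg[of F z] that by (auto simp: F'_def degree_pderiv)
  have same: "degree (G y) = degree (G y')" "G y = 0 \<longleftrightarrow> G y' = 0"
    "sgn (lead_coeff (G y)) = sgn (lead_coeff (G y'))" if "G \<in> insert F ?N" for G
    using degree_eq_of_sgn_coeff[OF deg'[OF that] deg'[OF that] sgn_coeff[OF that]] by blast+
  show ?thesis
  proof (cases "coeff (F y) D = 0")
    case True
    have "coeff (F y') D = 0" using True sgn_coeff[of F D] by (simp add: sgn_zero_iff)
    have cutoff: "poly_cutoff D (F z) = F z" if "coeff (F z) D = 0" for z
    proof (rule poly_cutoff_eq_self)
      fix i assume "D \<le> i"
      then show "coeff (F z) i = 0"
        using that deg[of F z] by (cases "i = D") (auto intro: coeff_eq_0)
    qed
    show ?thesis unfolding sign_match_def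
      using \<phi> sgn_N sgn_cutoff cutoff[OF True] cutoff[OF \<open>coeff (F y') D = 0\<close>] by auto
  next
    case False
    then have degF: "degree (F y) = D" using deg[of F y] le_degree[of "F y" D] by auto
    have F'_nz: "F' y \<noteq> 0" using degF D by (auto simp: F'_def pderiv_eq_0_iff)
    obtain lo hi where ends:
        "\<And>x z. x \<le> lo \<Longrightarrow> z \<le> lo \<Longrightarrow> sgn (poly (F y) x) = sgn (poly (F y') (\<phi> z)) \<and> poly (F y) x \<noteq> 0"
        "\<And>x z. x \<ge> hi \<Longrightarrow> z \<ge> hi \<Longrightarrow> sgn (poly (F y) x) = sgn (poly (F y') (\<phi> z)) \<and> poly (F y) x \<noteq> 0"
      using common_sgn_at_ends[OF \<phi>, of "F y" "F y'"] same[of F] degF D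
      by (metis degree_0 insertI1 not_one_le_zero)
    \<comment> \<open>\<open>lo\<close> and \<open>hi\<close> are added so that \<open>S\<close> also separates the ends, where \<open>F\<close> has settled its sign.\<close>
    define S where "S = insert lo (insert hi (\<Union>G\<in>{G \<in> ?N. G y \<noteq> 0}. {x. poly (G y) x = 0}))"
    have S: "finite S" "lo \<in> S" "hi \<in> S" using L by (auto simp: S_def poly_roots_finite)
    have off_S: "poly (G y) x \<noteq> 0" if "G \<in> ?N" "G y \<noteq> 0" "x \<notin> S" for G x
      using that by (auto simp: S_def)
    have "\<exists>\<phi>'. order_iso \<phi>' \<and> (\<forall>s\<in>S. \<phi>' s = \<phi> s) \<and> (\<forall>x. sgn (poly (F y) x) = sgn (poly (F y') (\<phi>' x)))"
    proof (rule sgn_match_adjust[OF \<phi> S _ _ _ ends])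
      fix s assume "s \<in> S"
      then consider "s = lo" | "s = hi" | G where "G \<in> ?N" "G y \<noteq> 0" "poly (G y) s = 0"
        by (auto simp: S_def)
      then show "sgn (poly (F y) s) = sgn (poly (F y') (\<phi> s))"
      proof cases
        case 1 then show ?thesis using ends(1) by blast
      next
        case 2 then show ?thesis using ends(2) by blast
      next
        case 3
        define e where "e = degree (G y)"
        have e: "e \<le> D" "degree (G y') = e" using deg'[of G y] same(1)[of G] 3(1) by (auto simp: e_def)
        have nz: "coeff (G y) e \<noteq> 0" using 3(2) by (simp add: e_def)
        have nz': "coeff (G y') e \<noteq> 0"
          using 3(1,2) same(2)[of G] leading_coeff_0_iff[of "G y'"] by (simp add: e(2))
        have root': "poly (G y') (\<phi> s) = 0" using sgn_N[OF 3(1), of s] 3(3) by (simp add: sgn_zero_iff)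
        have "sgn ((coeff (G y) e)\<^sup>2 * poly (F y) s) = sgn ((coeff (G y') e)\<^sup>2 * poly (F y') (\<phi> s))"
          using sgn_cancel[OF 3(1) e(1), of s] poly_lead_cancel_at_root[of "F y" D "G y" e s]
            poly_lead_cancel_at_root[of "F y'" D "G y'" e "\<phi> s"] deg[of F y] deg[of F y'] e 3(3) root'
          by (simp add: e_def)
        moreover have "sgn ((coeff (G y) e)\<^sup>2) = 1" "sgn ((coeff (G y') e)\<^sup>2) = 1"
          using nz nz' by (simp_all add: sgn_if)
        ultimately show ?thesis by (simp only: sgn_mult mult_1_left)
      qed
    next
      show "poly (pderiv (F y)) x \<noteq> 0" if "x \<notin> S" for x
        using off_S[of F' x] F'_nz that by (simp add: F'_def)
      show "sgn (poly (pderiv (F y)) x) = sgn (poly (pderiv (F y')) (\<phi> x))" for x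
        using sgn_N[of F' x] by (simp add: F'_def)
    qed
    then obtain \<phi>' where \<phi>': "order_iso \<phi>'" "\<And>s. s \<in> S \<Longrightarrow> \<phi>' s = \<phi> s"
        "\<And>x. sgn (poly (F y) x) = sgn (poly (F y') (\<phi>' x))" by blast
    have "sgn (poly (G y) x) = sgn (poly (G y') (\<phi>' x))" if G: "G \<in> L" for G x
    proof (cases "G y = 0 \<or> x \<in> S")
      case True
      then show ?thesis using same(2)[of G] G sgn_N[of G x] \<phi>'(2)[of x] by auto
    next
      case False
      \<comment> \<open>A root of \<open>G y'\<close> between \<open>\<phi> x\<close> and \<open>\<phi>' x\<close> would be the common image of a point of \<open>S\<close> under both
         maps, on one side of \<open>x\<close>, contradicting monotonicity.\<close>
      have nz: "poly (G y') t \<noteq> 0" if t: "min (\<phi> x) (\<phi>' x) \<le> t" "t \<le> max (\<phi> x) (\<phi>' x)" for t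
      proof
        assume root: "poly (G y') t = 0"
        obtain s where s: "t = \<phi> s" using \<phi> by (metis order_iso_def surjD)
        have "poly (G y) s = 0" using sgn_N[of G s] root s G by (simp add: sgn_zero_iff)
        then have "s \<in> S" using off_S[of G s] G False by auto
        then have "\<phi>' s = \<phi> s" "s \<noteq> x" using \<phi>'(2) False by auto
        then show False
          using t s order_iso_less_iff[OF \<phi>, of s x] order_iso_less_iff[OF \<phi>'(1), of s x]
            order_iso_less_iff[OF \<phi>, of x s] order_iso_less_iff[OF \<phi>'(1), of x s]
          by (cases s x rule: linorder_cases) auto
      qed
      have "sgn (poly (G y') (\<phi> x)) = sgn (poly (G y') (\<phi>' x))"
      proof (rule ccontr)
        assume ne: "sgn (poly (G y') (\<phi> x)) \<noteq> sgn (poly (G y') (\<phi>' x))"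
        have "poly (G y') (\<phi> x) \<noteq> 0" "poly (G y') (\<phi>' x) \<noteq> 0" using nz by auto
        with ne have neg: "poly (G y') (\<phi> x) * poly (G y') (\<phi>' x) < 0"
          by (auto simp: sgn_if mult_less_0_iff split: if_splits)
        have "\<phi> x \<noteq> \<phi>' x" using ne by auto
        then show False
          using poly_IVT[of "\<phi> x" "\<phi>' x" "G y'"] poly_IVT[of "\<phi>' x" "\<phi> x" "G y'"] neg nz
          by (metis linorder_neqE less_imp_le max.coboundedI1 max.coboundedI2 min.coboundedI1
                min.coboundedI2 mult.commute)
      qed
      then show ?thesis using sgn_N[of G x] G by simp
    qed
    then show ?thesis unfolding sign_match_def using \<phi>'(1,3) by blast
  qed
qed

definition function_ring :: "('y \<Rightarrow> real) set \<Rightarrow> bool" where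
  "function_ring R \<longleftrightarrow> (\<forall>c. (\<lambda>_. c) \<in> R) \<and>
     (\<forall>f\<in>R. \<forall>g\<in>R. (\<lambda>y. f y + g y) \<in> R \<and> (\<lambda>y. f y * g y) \<in> R)"

lemma function_ring_const: "function_ring R \<Longrightarrow> (\<lambda>_. c) \<in> R"
  and function_ring_add: "function_ring R \<Longrightarrow> f \<in> R \<Longrightarrow> g \<in> R \<Longrightarrow> (\<lambda>y. f y + g y) \<in> R"
  and function_ring_mult: "function_ring R \<Longrightarrow> f \<in> R \<Longrightarrow> g \<in> R \<Longrightarrow> (\<lambda>y. f y * g y) \<in> R"
  by (auto simp: function_ring_def)

lemma function_ring_diff:
  assumes "function_ring R" "f \<in> R" "g \<in> R"
  shows "(\<lambda>y. f y - g y) \<in> R"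
  using function_ring_add[OF assms(1,2) function_ring_mult[OF assms(1) function_ring_const[OF assms(1), of "-1"] assms(3)]]
  by simp

definition poly_family :: "('y \<Rightarrow> real) set \<Rightarrow> nat \<Rightarrow> ('y \<Rightarrow> real poly) \<Rightarrow> bool" where
  "poly_family R d F \<longleftrightarrow> (\<forall>y. degree (F y) \<le> d) \<and> (\<forall>i. (\<lambda>y. coeff (F y) i) \<in> R)"

lemma poly_family_cutoff:
  assumes "function_ring R" "\<And>i. (\<lambda>y. coeff (F y) i) \<in> R"
  shows "poly_family R d (\<lambda>y. poly_cutoff (Suc d) (F y))"
  unfolding poly_family_def
proof (intro conjI allI)
  show "degree (poly_cutoff (Suc d) (F y)) \<le> d" for y
    by (rule degree_le) (simp add: coeff_poly_cutoff)
  show "(\<lambda>y. coeff (poly_cutoff (Suc d) (F y)) i) \<in> R" for i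
    using assms by (cases "i < Suc d") (simp_all add: coeff_poly_cutoff function_ring_const)
qed

lemma poly_family_auxiliary:
  assumes R: "function_ring R" and fam: "\<And>G. G \<in> insert F L \<Longrightarrow> poly_family R (Suc d) G"
    and X: "X \<in> auxiliary_families (Suc d) F L"
  shows "poly_family R d X"
proof -
  define F' where "F' = (\<lambda>y. pderiv (F y))"
  have F: "poly_family R (Suc d) F" using fam by simp
  have F': "poly_family R d F'"
    using F function_ring_mult[OF R function_ring_const[OF R]]
    by (simp add: poly_family_def F'_def degree_pderiv coeff_pderiv le_diff_conv del: of_nat_Suc)
  have coeffs: "(\<lambda>y. coeff (G y) i) \<in> R" if "G \<in> insert F (insert F' L)" for G i
    using that fam F' by (auto simp: poly_family_def)
  consider "X = F'" | "X = (\<lambda>y. poly_cutoff (Suc d) (F y))"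
    | G e where "G \<in> insert F' L" "X = (\<lambda>y. lead_cancel (Suc d) e (F y) (G y))"
    | G e where "G \<in> insert F (insert F' L)" "X = (\<lambda>y. [:coeff (G y) e:])"
    using X unfolding auxiliary_families_def Let_def F'_def by auto
  then show ?thesis
  proof cases
    case 1 then show ?thesis using F' by simp
  next
    case 2 then show ?thesis using poly_family_cutoff[OF R] coeffs by simp
  next
    case 3
    have G: "(\<lambda>y. coeff (G y) i) \<in> R" and F: "(\<lambda>y. coeff (F y) i) \<in> R" for i
      using coeffs 3(1) by auto
    have mono: "(\<lambda>y. coeff (monom 1 k * G y) i) \<in> R" for k i
      using G by (cases "i < k") (simp_all add: coeff_monom_mult function_ring_const[OF R])
    then show ?thesis
      unfolding 3(2) lead_cancel_def
      by (intro poly_family_cutoff[OF R])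
        (simp add: power2_eq_square function_ring_diff[OF R] function_ring_mult[OF R] G F mono)
  next
    case 4
    have "(\<lambda>y. coeff [:coeff (G y) e:] i) \<in> R" for i
      using coeffs[OF 4(1)] by (cases i) (simp_all add: function_ring_const[OF R])
    then show ?thesis using 4(2) by (simp add: poly_family_def)
  qed
qed

lemma finite_auxiliary_families: "finite L \<Longrightarrow> finite (auxiliary_families D F L)"
  by (simp add: auxiliary_families_def Let_def)

text \<open>
  The sign table of finitely many parametric polynomials depends only on the signs of finitely many
  functions of the parameter, obtained from the coefficients by ring operations. The induction is on
  the degree bound and, within it, on the set \<open>H\<close> of families of the top degree: one of them is traded
  for auxiliary families of smaller degree.
\<close>

lemma sign_match_finite_test:
  assumes R: "function_ring R" and "finite L" "\<And>F. F \<in> L \<Longrightarrow> poly_family R d F"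
  shows "\<exists>C. finite C \<and> C \<subseteq> R \<and> (\<forall>y y'. (\<forall>c\<in>C. sgn (c y) = sgn (c y')) \<longrightarrow> sign_match L y y')"
  using assms(2,3)
proof (induction d arbitrary: L)
  case 0
  have const: "F y = [:coeff (F y) 0:]" if "F \<in> L" for F y
  proof -
    have "degree (F y) = 0" using 0(2)[OF that] by (simp add: poly_family_def)
    then show ?thesis by (metis coeff_pCons_0 degree_eq_zeroE)
  qed
  show ?case
  proof (intro exI[of _ "(\<lambda>F y. coeff (F y) 0) ` L"] conjI allI impI)
    fix y y' assume eq: "\<forall>c\<in>(\<lambda>F y. coeff (F y) 0) ` L. sgn (c y) = sgn (c y')"
    have "sgn (poly (F y) x) = sgn (poly (F y') x)" if "F \<in> L" for F x
      using const[OF that, of y] const[OF that, of y'] eq that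
      by (metis (no_types, lifting) add.right_neutral image_eqI mult_zero_right poly_0 poly_pCons)
    then show "sign_match L y y'"
      unfolding sign_match_def by (intro exI[of _ id]) (auto simp: order_iso_def strict_mono_def)
  qed (use 0 in \<open>auto simp: poly_family_def\<close>)
next
  case (Suc d)
  have "\<exists>C. finite C \<and> C \<subseteq> R \<and> (\<forall>y y'. (\<forall>c\<in>C. sgn (c y) = sgn (c y')) \<longrightarrow> sign_match (H \<union> K) y y')"
    if "finite H" "\<And>F. F \<in> H \<Longrightarrow> poly_family R (Suc d) F" "finite K" "\<And>F. F \<in> K \<Longrightarrow> poly_family R d F"
    for H K
    using that
  proof (induction H arbitrary: K rule: finite_induct)
    case empty
    then show ?case using Suc.IH[of K] by simp
  next
    case (insert F H)
    let ?L = "H \<union> K"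
    have fam: "poly_family R (Suc d) G" if "G \<in> insert F ?L" for G
      using that insert.prems(1)[of G] insert.prems(3)[of G] by (auto simp: poly_family_def le_SucI)
    have "\<exists>C. finite C \<and> C \<subseteq> R \<and> (\<forall>y y'. (\<forall>c\<in>C. sgn (c y) = sgn (c y')) \<longrightarrow>
        sign_match (H \<union> (K \<union> auxiliary_families (Suc d) F ?L)) y y')"
    proof (rule insert.IH)
      show "finite (K \<union> auxiliary_families (Suc d) F ?L)"
        using insert.prems insert.hyps by (simp add: finite_auxiliary_families)
      show "poly_family R d X" if "X \<in> K \<union> auxiliary_families (Suc d) F ?L" for X
        using that insert.prems(3) poly_family_auxiliary[OF R fam, of F ?L X] by blast
    qed (use insert.prems in simp)
    then obtain C where C: "finite C" "C \<subseteq> R" "\<And>y y'. (\<forall>c\<in>C. sgn (c y) = sgn (c y')) \<Longrightarrow>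
        sign_match (?L \<union> auxiliary_families (Suc d) F ?L) y y'"
      by (auto simp: Un_assoc)
    have "sign_match (insert F ?L) y y'" if "\<forall>c\<in>C. sgn (c y) = sgn (c y')" for y y'
      using sign_match_step[OF _ _ _ C(3)[OF that]] insert.hyps insert.prems fam
      by (simp add: poly_family_def)
    then show ?case using C by auto
  qed
  from this[OF Suc.prems, of "{}"] show ?case by simp
qed

section \<open>Projection of semialgebraic conditions\<close>

lemma function_ring_sum:
  assumes "function_ring R" "\<And>i. i \<in> I \<Longrightarrow> f i \<in> R"
  shows "(\<lambda>y. \<Sum>i\<in>I. f i y) \<in> R"
  using assms(2)
  by (induction I rule: infinite_finite_induct)
    (simp_all add: function_ring_const[OF assms(1)] function_ring_add[OF assms(1)])

inductive semialg :: "('y \<Rightarrow> real) set \<Rightarrow> ('y \<Rightarrow> bool) \<Rightarrow> bool" for R where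
  semialg_pos: "f \<in> R \<Longrightarrow> semialg R (\<lambda>y. f y > 0)"
| semialg_neg: "semialg R P \<Longrightarrow> semialg R (\<lambda>y. \<not> P y)"
| semialg_conj: "semialg R P \<Longrightarrow> semialg R Q \<Longrightarrow> semialg R (\<lambda>y. P y \<and> Q y)"

lemma semialg_disj: "semialg R P \<Longrightarrow> semialg R Q \<Longrightarrow> semialg R (\<lambda>y. P y \<or> Q y)"
  using semialg_neg[OF semialg_conj[OF semialg_neg semialg_neg]] by force

lemma semialg_const:
  assumes "function_ring R"
  shows "semialg R (\<lambda>_. b)"
  using semialg_pos[OF function_ring_const[OF assms, of "if b then 1 else 0"]] by (cases b) simp_all

lemma semialg_less:
  assumes "function_ring R" "f \<in> R" "g \<in> R"
  shows "semialg R (\<lambda>y. f y < g y)"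
  using semialg_pos[OF function_ring_diff[OF assms(1,3,2)]] by simp

lemma semialg_le:
  assumes "function_ring R" "f \<in> R" "g \<in> R"
  shows "semialg R (\<lambda>y. f y \<le> g y)"
  using semialg_neg[OF semialg_less[OF assms(1,3,2)]] by (simp add: not_less)

lemma semialg_eq:
  assumes "function_ring R" "f \<in> R" "g \<in> R"
  shows "semialg R (\<lambda>y. f y = g y)"
  using semialg_conj[OF semialg_le[OF assms] semialg_le[OF assms(1,3,2)]] by (simp add: order_eq_iff)

lemma semialg_ball:
  assumes "function_ring R" "finite I" "\<And>i. i \<in> I \<Longrightarrow> semialg R (P i)"
  shows "semialg R (\<lambda>y. \<forall>i\<in>I. P i y)"
  using assms(2,3)
  by (induction I rule: finite_induct) (simp_all add: semialg_const[OF assms(1)] semialg_conj)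

text \<open>
  Only finitely many sign vectors of \<open>C\<close> exist, each singled out by a semialgebraic condition. Splitting
  off one function \<open>c\<close> at a time avoids naming the vectors: for each of the three signs of \<open>c\<close>, the
  condition is replaced by one that depends on the signs of the remaining functions only.
\<close>

lemma semialg_if_sign_determined:
  assumes R: "function_ring R" and "finite C" "C \<subseteq> R"
    and "\<And>y y'. (\<forall>c\<in>C. sgn (c y) = sgn (c y')) \<Longrightarrow> P y \<Longrightarrow> P y'"
  shows "semialg R P"
  using assms(2-)
proof (induction C arbitrary: P rule: finite_induct)
  case empty
  then have "P = (\<lambda>_. \<exists>y. P y)" by auto
  then show ?case using semialg_const[OF R] by metis
next
  case (insert c C)
  have c: "c \<in> R" and zero: "(\<lambda>_. 0) \<in> R" using insert.prems function_ring_const[OF R] by auto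
  define Q where "Q s y \<longleftrightarrow> (\<exists>z. sgn (c z) = s \<and> (\<forall>d\<in>C. sgn (d z) = sgn (d y)) \<and> P z)" for s y
  have Q: "semialg R (Q s)" for s
    by (rule insert.IH) (use insert.prems in \<open>auto simp: Q_def\<close>)
  have "P y \<longleftrightarrow> (0 < c y \<and> Q 1 y) \<or> (c y < 0 \<and> Q (-1) y) \<or> (c y = 0 \<and> Q 0 y)" for y
  proof -
    have "P y \<longleftrightarrow> Q (sgn (c y)) y"
      using insert.prems(2)[of _ y] unfolding Q_def by auto
    then show ?thesis by (cases "c y" "0 :: real" rule: linorder_cases) simp_all
  qed
  then have "P = (\<lambda>y. (0 < c y \<and> Q 1 y) \<or> (c y < 0 \<and> Q (-1) y) \<or> (c y = 0 \<and> Q 0 y))" by blast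
  moreover have "semialg R \<dots>"
    by (intro semialg_disj semialg_conj Q semialg_less[OF R] semialg_eq[OF R] c zero)
  ultimately show ?case by simp
qed

text \<open>
  Keeping all variables in one assignment turns quantification into an update of it.
\<close>

inductive_set polyfun :: "(('v \<Rightarrow> real) \<Rightarrow> real) set" where
  polyfun_const: "(\<lambda>_. c) \<in> polyfun"
| polyfun_var: "(\<lambda>e. e v) \<in> polyfun"
| polyfun_add: "f \<in> polyfun \<Longrightarrow> g \<in> polyfun \<Longrightarrow> (\<lambda>e. f e + g e) \<in> polyfun"
| polyfun_mult: "f \<in> polyfun \<Longrightarrow> g \<in> polyfun \<Longrightarrow> (\<lambda>e. f e * g e) \<in> polyfun"

lemma function_ring_polyfun: "function_ring polyfun"
  by (simp add: function_ring_def polyfun.intros)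

lemma polyfun_univariate:
  assumes "f \<in> polyfun"
  shows "\<exists>d F. poly_family polyfun d F \<and> (\<forall>e x. poly (F e) x = f (e(k := x)))"
  using assms
proof (induction rule: polyfun.induct)
  case (polyfun_const c)
  have "poly_family polyfun 0 (\<lambda>_. [:c:])"
    by (simp add: poly_family_def polyfun.polyfun_const)
  then show ?case by (intro exI[of _ 0] exI[of _ "\<lambda>_. [:c:]"]) simp
next
  case (polyfun_var v)
  show ?case
  proof (cases "v = k")
    case True
    have "poly_family polyfun 1 (\<lambda>_. [:0, 1:])"
      by (simp add: poly_family_def polyfun.polyfun_const)
    then show ?thesis using True by (intro exI[of _ 1] exI[of _ "\<lambda>_. [:0, 1:]"]) simp
  next
    case False
    have "(\<lambda>e. coeff [:e v:] i) \<in> polyfun" for i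
      by (cases i) (simp_all add: polyfun.intros)
    then have "poly_family polyfun 0 (\<lambda>e. [:e v:])" by (simp add: poly_family_def)
    then show ?thesis using False by (intro exI[of _ 0] exI[of _ "\<lambda>e. [:e v:]"]) simp
  qed
next
  case (polyfun_add f g)
  then obtain d d' F G where F: "poly_family polyfun d F" "\<And>e x. poly (F e) x = f (e(k := x))"
    and G: "poly_family polyfun d' G" "\<And>e x. poly (G e) x = g (e(k := x))" by blast
  have "poly_family polyfun (max d d') (\<lambda>e. F e + G e)"
    using F(1) G(1) unfolding poly_family_def
    by (auto simp: polyfun.polyfun_add intro: order_trans[OF degree_add_le_max max.mono])
  then show ?case using F(2) G(2) by (intro exI[of _ "max d d'"] exI[of _ "\<lambda>e. F e + G e"]) (simp add: fun_upd_def)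
next
  case (polyfun_mult f g)
  then obtain d d' F G where F: "poly_family polyfun d F" "\<And>e x. poly (F e) x = f (e(k := x))"
    and G: "poly_family polyfun d' G" "\<And>e x. poly (G e) x = g (e(k := x))" by blast
  have "degree (F e * G e) \<le> d + d'" for e
    using degree_mult_le[of "F e" "G e"] F(1) G(1) unfolding poly_family_def
    by (meson add_mono order_trans)
  moreover have "(\<lambda>e. coeff (F e * G e) i) \<in> polyfun" for i
    using F(1) G(1) unfolding poly_family_def coeff_mult
    by (intro function_ring_sum[OF function_ring_polyfun]) (simp add: polyfun.polyfun_mult)
  ultimately have "poly_family polyfun (d + d') (\<lambda>e. F e * G e)" by (simp add: poly_family_def)
  then show ?case using F(2) G(2) by (intro exI[of _ "d + d'"] exI[of _ "\<lambda>e. F e * G e"]) (simp add: fun_upd_def)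
qed

lemma poly_family_mono: "poly_family R d F \<Longrightarrow> d \<le> d' \<Longrightarrow> poly_family R d' F"
  by (auto simp: poly_family_def intro: order_trans)

text \<open>
  Along a single variable \<open>k\<close>, a semialgebraic condition is a condition on the signs of finitely many
  univariate polynomials whose coefficients are polynomial in the assignment.
\<close>

lemma semialg_fibre_signs:
  assumes "semialg polyfun P"
  shows "\<exists>d L. finite L \<and> (\<forall>F\<in>L. poly_family polyfun d F) \<and>
    (\<forall>e e' x x'. (\<forall>F\<in>L. sgn (poly (F e) x) = sgn (poly (F e') x')) \<longrightarrow>
      P (e(k := x)) = P (e'(k := x')))"
  using assms
proof (induction rule: semialg.induct)
  case (semialg_pos f)
  obtain d F where F: "poly_family polyfun d F" "\<And>e x. poly (F e) x = f (e(k := x))"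
    using polyfun_univariate[OF semialg_pos] by blast
  have "0 < f (e(k := x)) \<longleftrightarrow> 0 < f (e'(k := x'))"
    if "sgn (poly (F e) x) = sgn (poly (F e') x')" for e e' x x'
    using that F(2) by (metis sgn_greater)
  then have "\<forall>e e' x x'. (\<forall>F\<in>{F}. sgn (poly (F e) x) = sgn (poly (F e') x')) \<longrightarrow>
      (0 < f (e(k := x))) = (0 < f (e'(k := x')))" by blast
  then show ?case using F(1) by blast
next
  case (semialg_neg P)
  then show ?case by (metis (no_types, lifting))
next
  case (semialg_conj P Q)
  obtain d L where L: "finite L" "\<forall>F\<in>L. poly_family polyfun d F"
    "\<And>e e' x x'. (\<forall>F\<in>L. sgn (poly (F e) x) = sgn (poly (F e') x')) \<Longrightarrow> P (e(k := x)) = P (e'(k := x'))"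
    using semialg_conj.IH(1) by blast
  obtain d' L' where L': "finite L'" "\<forall>F\<in>L'. poly_family polyfun d' F"
    "\<And>e e' x x'. (\<forall>F\<in>L'. sgn (poly (F e) x) = sgn (poly (F e') x')) \<Longrightarrow> Q (e(k := x)) = Q (e'(k := x'))"
    using semialg_conj.IH(2) by blast
  show ?case
  proof (intro exI[of _ "max d d'"] exI[of _ "L \<union> L'"] conjI ballI allI impI)
    fix F assume "F \<in> L \<union> L'"
    then show "poly_family polyfun (max d d') F"
      using L(2) L'(2) by (auto intro: poly_family_mono)
  next
    fix e e' x x' assume eq: "\<forall>F\<in>L \<union> L'. sgn (poly (F e) x) = sgn (poly (F e') x')"
    show "(P (e(k := x)) \<and> Q (e(k := x))) = (P (e'(k := x')) \<and> Q (e'(k := x')))"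
      using L(3)[of e x e' x'] L'(3)[of e x e' x'] eq by blast
  qed (use L(1) L'(1) in simp)
qed

text \<open>
  The Tarski--Seidenberg theorem. Whether a point with prescribed signs exists on the fibre depends
  only on the sign table of the fibre, since a matching of sign tables carries such a point to another,
  and the sign table is determined by the signs of finitely many polynomial functions.
\<close>

lemma semialg_projection:
  assumes "semialg polyfun P"
  shows "semialg polyfun (\<lambda>e. \<exists>x. P (e(k := x)))"
proof -
  obtain d L where L: "finite L" "\<And>F. F \<in> L \<Longrightarrow> poly_family polyfun d F"
    "\<And>e e' x x'. (\<forall>F\<in>L. sgn (poly (F e) x) = sgn (poly (F e') x')) \<Longrightarrow> P (e(k := x)) = P (e'(k := x'))"
    using semialg_fibre_signs[OF assms, of k] by blast
  obtain C where C: "finite C" "C \<subseteq> polyfun" "\<And>e e'. (\<forall>c\<in>C. sgn (c e) = sgn (c e')) \<Longrightarrow> sign_match L e e'"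
    using sign_match_finite_test[OF function_ring_polyfun L(1,2)] by blast
  show ?thesis
  proof (rule semialg_if_sign_determined[OF function_ring_polyfun C(1,2)])
    fix e e' assume "\<forall>c\<in>C. sgn (c e) = sgn (c e')" and "\<exists>x. P (e(k := x))"
    then obtain \<phi> x where "\<forall>F\<in>L. sgn (poly (F e) x) = sgn (poly (F e') (\<phi> x))" and "P (e(k := x))"
      using C(3) unfolding sign_match_def by blast
    then show "\<exists>x. P (e'(k := x))" using L(3) by blast
  qed
qed

lemma semialg_ex_vars:
  assumes "finite V" "semialg polyfun P"
  shows "semialg polyfun (\<lambda>e. \<exists>f. P (\<lambda>v. if v \<in> V then f v else e v))"
  using assms
proof (induction V arbitrary: P rule: finite_induct)
  case empty
  then show ?case by simp
next
  case (insert k V)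
  have "(\<exists>f x. P ((\<lambda>v. if v \<in> V then f v else e v)(k := x))) \<longleftrightarrow>
      (\<exists>f. P (\<lambda>v. if v \<in> insert k V then f v else e v))" for e
  proof
    assume "\<exists>f x. P ((\<lambda>v. if v \<in> V then f v else e v)(k := x))"
    then obtain f x where *: "P ((\<lambda>v. if v \<in> V then f v else e v)(k := x))" by blast
    have "(\<lambda>v. if v \<in> V then f v else e v)(k := x) = (\<lambda>v. if v \<in> insert k V then (f(k := x)) v else e v)"
      by auto
    with * show "\<exists>f. P (\<lambda>v. if v \<in> insert k V then f v else e v)" by metis
  next
    assume "\<exists>f. P (\<lambda>v. if v \<in> insert k V then f v else e v)"
    then obtain f where *: "P (\<lambda>v. if v \<in> insert k V then f v else e v)" by blast
    have "(\<lambda>v. if v \<in> insert k V then f v else e v) = (\<lambda>v. if v \<in> V then f v else e v)(k := f k)"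
      by auto
    with * show "\<exists>f x. P ((\<lambda>v. if v \<in> V then f v else e v)(k := x))" by metis
  qed
  then show ?case using insert.IH[OF semialg_projection[OF insert.prems, of k]] by (simp only:)
qed

text \<open>
  The variables \<open>g j\<close> serve as the coordinates of the quantified vector. They are bound, so \<open>Q\<close> must not
  depend on their values in the assignment.
\<close>

lemma semialg_ex_vec:
  fixes Q :: "('v \<Rightarrow> real) \<Rightarrow> real ^ 'k::finite \<Rightarrow> bool" and g :: "'k \<Rightarrow> 'v"
  assumes "inj g" and sa: "semialg polyfun (\<lambda>e. Q e (\<chi> j. e (g j)))"
    and indep: "\<And>e e' u. (\<And>v. v \<notin> range g \<Longrightarrow> e v = e' v) \<Longrightarrow> Q e u \<Longrightarrow> Q e' u"
  shows "semialg polyfun (\<lambda>e. \<exists>u. Q e u)"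
proof -
  have eq: "(\<exists>f. Q (\<lambda>v. if v \<in> range g then f v else e v)
      (\<chi> j. if g j \<in> range g then f (g j) else e (g j))) \<longleftrightarrow> (\<exists>u. Q e u)" for e
  proof
    assume "\<exists>f. Q (\<lambda>v. if v \<in> range g then f v else e v) (\<chi> j. if g j \<in> range g then f (g j) else e (g j))"
    then obtain f where "Q (\<lambda>v. if v \<in> range g then f v else e v) (\<chi> j. f (g j))" by auto
    then have "Q e (\<chi> j. f (g j))" by (rule indep[rotated]) simp
    then show "\<exists>u. Q e u" ..
  next
    assume "\<exists>u. Q e u"
    then obtain u where u: "Q e u" ..
    define f where "f v = u $ inv g v" for v
    have "Q (\<lambda>v. if v \<in> range g then f v else e v) u" using u by (rule indep[rotated]) simp
    moreover have "(\<chi> j. if g j \<in> range g then f (g j) else e (g j)) = u"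
      using \<open>inj g\<close> by (simp add: f_def vec_eq_iff)
    ultimately show "\<exists>f. Q (\<lambda>v. if v \<in> range g then f v else e v)
        (\<chi> j. if g j \<in> range g then f (g j) else e (g j))" by metis
  qed
  have "finite (range g)" by simp
  from semialg_ex_vars[OF this sa] show ?thesis by (simp only: eq)
qed

lemma finite_frontier_poly_pos:
  fixes p :: "real poly"
  shows "finite (frontier {t. poly p t > 0})"
proof (cases "p = 0")
  case False
  have "open {t. poly p t > 0}" by (intro open_Collect_less continuous_intros)
  moreover have "closure {t. poly p t > 0} \<subseteq> {t. poly p t \<ge> 0}"
    by (intro closure_minimal closed_Collect_le continuous_intros) auto
  ultimately have "frontier {t. poly p t > 0} \<subseteq> {t. poly p t = 0}"
    by (auto simp: frontier_def interior_open)
  then show ?thesis using poly_roots_finite[OF False] finite_subset by blast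
qed simp

text \<open>
  In one variable a semialgebraic set can change only at roots of the nonzero polynomials defining it.
\<close>

lemma finite_frontier_semialg:
  assumes "semialg polyfun P"
  shows "finite (frontier {t. P (e(k := t))})"
  using assms
proof (induction rule: semialg.induct)
  case (semialg_pos f)
  obtain F where F: "\<And>e x. poly (F e) x = f (e(k := x))" using polyfun_univariate[OF semialg_pos] by blast
  show ?case using finite_frontier_poly_pos[of "F e"] by (simp only: F)
next
  case (semialg_neg P)
  then show ?case using frontier_complement[of "{t. P (e(k := t))}"] by (simp add: Collect_neg_eq fun_upd_def)
next
  case (semialg_conj P Q)
  then show ?case
    using finite_subset[OF frontier_Int_subset[of "{t. P (e(k := t))}" "{t. Q (e(k := t))}"]]
    by (simp add: Collect_conj_eq fun_upd_def)
qed

section \<open>Optimality as a semialgebraic condition\<close>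

text \<open>
  The variables of the formulas expressing optimality: the parameter \<open>\<epsilon>\<close>, the coordinates of \<open>x\<close>, \<open>y\<close>
  and \<open>s\<close>, a competing feasible point against which optimality is tested, and a positive slack
  for approximating an infimum.
\<close>

datatype ('n, 'm) soco_var = Parameter | Slack | Primal 'n | Multiplier 'm | Dual 'n | Competitor 'n

definition polyvec :: "(('v \<Rightarrow> real) \<Rightarrow> real ^ 'k) \<Rightarrow> bool" where
  "polyvec u \<longleftrightarrow> (\<forall>j. (\<lambda>e. u e $ j) \<in> polyfun)"

lemma polyvec_coordinates: "polyvec (\<lambda>e. \<chi> j. e (g j))"
  by (simp add: polyvec_def polyfun_var)

lemma polyvec_add: "polyvec u \<Longrightarrow> polyvec w \<Longrightarrow> polyvec (\<lambda>e. u e + w e)"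
  by (simp add: polyvec_def polyfun_add)

lemma polyvec_const: "polyvec (\<lambda>_. w)"
  by (simp add: polyvec_def polyfun_const)

lemma polyvec_matrix: "polyvec u \<Longrightarrow> polyvec (\<lambda>e. M *v u e)"
  unfolding polyvec_def matrix_vector_mult_def
  by (simp add: function_ring_sum[OF function_ring_polyfun] polyfun_mult polyfun_const)

lemma polyfun_inner: "polyvec u \<Longrightarrow> polyvec w \<Longrightarrow> (\<lambda>e. u e \<bullet> w e) \<in> polyfun"
  unfolding polyvec_def inner_vec_def
  by (simp add: function_ring_sum[OF function_ring_polyfun] polyfun_mult)

lemmas semialg_less_poly = semialg_less[OF function_ring_polyfun]
  and semialg_le_poly = semialg_le[OF function_ring_polyfun]
  and semialg_eq_poly = semialg_eq[OF function_ring_polyfun]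
  and semialg_ball_poly = semialg_ball[OF function_ring_polyfun]

lemma semialg_vec_eq:
  assumes "polyvec u" "polyvec w"
  shows "semialg polyfun (\<lambda>e. u e = w e)"
proof -
  have "semialg polyfun (\<lambda>e. \<forall>j\<in>UNIV. u e $ j = w e $ j)"
    using assms by (intro semialg_ball_poly semialg_eq_poly) (simp_all add: polyvec_def)
  then show ?thesis by (simp add: vec_eq_iff)
qed

lemma semialg_ex_var:
  fixes Q :: "('v \<Rightarrow> real) \<Rightarrow> real \<Rightarrow> bool"
  assumes "semialg polyfun (\<lambda>e. Q e (e k))"
    and "\<And>e e' x. (\<And>v. v \<noteq> k \<Longrightarrow> e v = e' v) \<Longrightarrow> Q e x \<Longrightarrow> Q e' x"
  shows "semialg polyfun (\<lambda>e. \<exists>x. Q e x)"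
proof -
  have "Q (e(k := x)) x \<longleftrightarrow> Q e x" for e x
    using assms(2)[of e "e(k := x)" x] assms(2)[of "e(k := x)" e x] by auto
  then show ?thesis using semialg_projection[OF assms(1), of k] by simp
qed

lemma L2_set_power2: "(L2_set v I)\<^sup>2 = (\<Sum>j\<in>I. (v j)\<^sup>2)"
  by (simp add: L2_set_def sum_nonneg)

lemma L2_set_le_iff: "L2_set v I \<le> a \<longleftrightarrow> 0 \<le> a \<and> (\<Sum>j\<in>I. (v j)\<^sup>2) \<le> a\<^sup>2"
  unfolding L2_set_power2[symmetric]
  using L2_set_nonneg[of v I] power2_le_imp_le[of "L2_set v I" a] power_mono[of "L2_set v I" a 2] by linarith

lemma L2_set_less_iff: "L2_set v I < a \<longleftrightarrow> 0 < a \<and> (\<Sum>j\<in>I. (v j)\<^sup>2) < a\<^sup>2"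
  unfolding L2_set_power2[symmetric]
  using L2_set_nonneg[of v I] power2_less_imp_less[of "L2_set v I" a]
    power_strict_mono[OF _ _ pos2, of "L2_set v I" a] by linarith

context soco_data
begin

definition semialg_block_set :: "nat \<Rightarrow> (nat \<Rightarrow> real) set \<Rightarrow> bool" where
  "semialg_block_set i K \<longleftrightarrow>
     (\<forall>u :: (('n, 'm) soco_var \<Rightarrow> real) \<Rightarrow> real ^ 'n. polyvec u \<longrightarrow> semialg polyfun (\<lambda>e. block (u e) i \<in> K))"

lemma polyfun_block: "polyvec u \<Longrightarrow> (\<lambda>e. block (u e) i j) \<in> polyfun"
  unfolding block_def polyvec_def
  by (cases "j \<in> {1..n i}") (simp_all only: if_True if_False polyfun_const simp_thms)

lemma polyfun_block_norm:
  "polyvec u \<Longrightarrow> (\<lambda>e. \<Sum>j\<in>J. (block (u e) i j)\<^sup>2) \<in> polyfun"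
  by (intro function_ring_sum[OF function_ring_polyfun]) (simp add: power2_eq_square polyfun_mult polyfun_block)

lemma block_euclid: "block x i \<in> euclid (n i)"
  by (auto simp: euclid_def block_def)

lemma semialg_soc: "semialg_block_set i (soc (n i))"
  unfolding semialg_block_set_def soc_def
  by (auto simp: block_euclid L2_set_le_iff power2_eq_square intro!: semialg_conj semialg_le_poly
      polyfun_const polyfun_mult polyfun_block polyfun_block_norm[unfolded power2_eq_square])

lemma semialg_soc_int: "semialg_block_set i (soc_int (n i))"
  unfolding semialg_block_set_def soc_int_def
  by (auto simp: block_euclid L2_set_less_iff power2_eq_square intro!: semialg_conj semialg_less_poly
      polyfun_const polyfun_mult polyfun_block polyfun_block_norm[unfolded power2_eq_square])

lemma semialg_block_minus:
  "semialg_block_set i K \<Longrightarrow> semialg_block_set i K' \<Longrightarrow> semialg_block_set i (K - K')"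
  by (simp add: semialg_block_set_def semialg_conj semialg_neg)

lemma soc_bd_eq: "soc_bd d = soc d - soc_int d"
  by (auto simp: soc_bd_def soc_def soc_int_def)

lemma semialg_UNIV: "semialg_block_set i UNIV"
  by (simp add: semialg_block_set_def semialg_const[OF function_ring_polyfun])

lemma semialg_zero_block: "semialg_block_set i {zero_block}"
proof -
  have "block x i = zero_block \<longleftrightarrow> (\<forall>j\<in>{1..n i}. block x i j = 0)" for x
    by (auto simp: zero_block_def block_def fun_eq_iff)
  then show ?thesis
    unfolding semialg_block_set_def
    by (auto intro!: semialg_ball_poly semialg_eq_poly polyfun_block polyfun_const)
qed

lemma semialg_cone_prod:
  fixes u :: "(('n, 'm) soco_var \<Rightarrow> real) \<Rightarrow> real ^ 'n"
  shows "polyvec u \<Longrightarrow> semialg polyfun (\<lambda>e. u e \<in> cone_prod)"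
  unfolding cone_prod_def mem_Collect_eq
  using semialg_soc by (intro semialg_ball_poly) (simp_all add: semialg_block_set_def)

lemma semialg_primal_feasible:
  fixes u :: "(('n, 'm) soco_var \<Rightarrow> real) \<Rightarrow> real ^ 'n"
  shows "polyvec u \<Longrightarrow> semialg polyfun (\<lambda>e. u e \<in> primal_feasible)"
  unfolding primal_feasible_def mem_Collect_eq
  by (intro semialg_conj semialg_cone_prod semialg_vec_eq polyvec_matrix polyvec_const)

lemma polyvec_cost: "polyvec (\<lambda>e. cost (e k))"
  unfolding polyvec_def cost_def by (simp add: polyfun_add polyfun_mult polyfun_const polyfun_var)

text \<open>
  Optimality in terms of comparisons with competitors only: the optimal value, an infimum in the
  extended reals, is eliminated.
\<close>

lemma primal_opt_iff:
  "x \<in> primal_opt \<epsilon> \<longleftrightarrow>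
     x \<in> primal_feasible \<and> \<not> (\<exists>u. u \<in> primal_feasible \<and> cost \<epsilon> \<bullet> u < cost \<epsilon> \<bullet> x)"
proof (cases "x \<in> primal_feasible")
  case True
  then have "\<psi> \<epsilon> \<le> ereal (cost \<epsilon> \<bullet> x)" unfolding \<psi>_def by (rule INF_lower)
  then have "ereal (cost \<epsilon> \<bullet> x) = \<psi> \<epsilon> \<longleftrightarrow> ereal (cost \<epsilon> \<bullet> x) \<le> \<psi> \<epsilon>" by auto
  also have "\<dots> \<longleftrightarrow> (\<forall>u\<in>primal_feasible. cost \<epsilon> \<bullet> x \<le> cost \<epsilon> \<bullet> u)"
    by (simp add: \<psi>_def le_INF_iff)
  finally show ?thesis using True by (auto simp: primal_opt_def not_less)
qed (simp add: primal_opt_def)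

text \<open>
  Here \<open>b \<bullet> y\<close> equals the infimum of the primal problem iff it is a lower bound and every number above
  it exceeds the cost of some feasible competitor. Both conditions are first-order.
\<close>

lemma dual_opt_iff:
  "(y, s) \<in> dual_opt \<epsilon> \<longleftrightarrow> (y, s) \<in> dual_feasible \<epsilon> \<and>
     \<not> (\<exists>u. u \<in> primal_feasible \<and> cost \<epsilon> \<bullet> u < b \<bullet> y) \<and>
     \<not> (\<exists>\<delta>. 0 < \<delta> \<and> \<not> (\<exists>u. u \<in> primal_feasible \<and> cost \<epsilon> \<bullet> u < b \<bullet> y + \<delta>))"
proof -
  have "ereal (b \<bullet> y) \<le> \<psi> \<epsilon> \<longleftrightarrow> (\<forall>u\<in>primal_feasible. b \<bullet> y \<le> cost \<epsilon> \<bullet> u)"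
    by (simp add: \<psi>_def le_INF_iff)
  moreover have "\<psi> \<epsilon> \<le> ereal (b \<bullet> y) \<longleftrightarrow> (\<forall>\<delta>>0. \<exists>u\<in>primal_feasible. cost \<epsilon> \<bullet> u < b \<bullet> y + \<delta>)"
  proof
    assume le: "\<psi> \<epsilon> \<le> ereal (b \<bullet> y)"
    show "\<forall>\<delta>>0. \<exists>u\<in>primal_feasible. cost \<epsilon> \<bullet> u < b \<bullet> y + \<delta>"
    proof (intro allI impI)
      fix \<delta> :: real assume "\<delta> > 0"
      with le have "\<psi> \<epsilon> < ereal (b \<bullet> y + \<delta>)" by (auto intro: le_less_trans)
      then show "\<exists>u\<in>primal_feasible. cost \<epsilon> \<bullet> u < b \<bullet> y + \<delta>"
        unfolding \<psi>_def INF_less_iff by simp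
    qed
  next
    assume near: "\<forall>\<delta>>0. \<exists>u\<in>primal_feasible. cost \<epsilon> \<bullet> u < b \<bullet> y + \<delta>"
    show "\<psi> \<epsilon> \<le> ereal (b \<bullet> y)"
    proof (rule ereal_le_epsilon2)
      fix \<delta> :: real assume "0 < \<delta>"
      then obtain u where "u \<in> primal_feasible" "cost \<epsilon> \<bullet> u < b \<bullet> y + \<delta>" using near by blast
      then show "\<psi> \<epsilon> \<le> ereal (b \<bullet> y) + ereal \<delta>"
        unfolding \<psi>_def by (intro INF_lower2[of u]) auto
    qed
  qed
  ultimately have eq: "ereal (b \<bullet> y) = \<psi> \<epsilon> \<longleftrightarrow> (\<forall>u\<in>primal_feasible. b \<bullet> y \<le> cost \<epsilon> \<bullet> u) \<and>
      (\<forall>\<delta>>0. \<exists>u\<in>primal_feasible. cost \<epsilon> \<bullet> u < b \<bullet> y + \<delta>)"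
    by (metis order_antisym order_refl)
  have le: "(\<forall>u\<in>primal_feasible. b \<bullet> y \<le> cost \<epsilon> \<bullet> u) \<longleftrightarrow>
      \<not> (\<exists>u. u \<in> primal_feasible \<and> cost \<epsilon> \<bullet> u < b \<bullet> y)"
    by (auto simp: not_less)
  show ?thesis unfolding dual_opt_def mem_Collect_eq prod.case eq le Bex_def by blast
qed

text \<open>
  The optimal partition is a function of the answers to questions of this form.
\<close>

definition primal_hits :: "nat \<Rightarrow> (nat \<Rightarrow> real) set \<Rightarrow> real \<Rightarrow> bool" where
  "primal_hits i K \<epsilon> \<longleftrightarrow> (\<exists>x. x \<in> primal_opt \<epsilon> \<and> block x i \<in> K)"

definition dual_hits :: "nat \<Rightarrow> (nat \<Rightarrow> real) set \<Rightarrow> real \<Rightarrow> bool" where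
  "dual_hits i K \<epsilon> \<longleftrightarrow> (\<exists>s y. (y, s) \<in> dual_opt \<epsilon> \<and> block s i \<in> K)"

text \<open>
  The pattern shared by primal and dual optimality: some feasible competitor is cheaper than a
  polynomial threshold \<open>r\<close> in the other variables.
\<close>

lemma semialg_competitor:
  fixes r :: "(('n, 'm) soco_var \<Rightarrow> real) \<Rightarrow> real"
  assumes "r \<in> polyfun" "\<And>e e'. (\<And>v. v \<notin> range Competitor \<Longrightarrow> e v = e' v) \<Longrightarrow> r e = r e'"
  shows "semialg polyfun (\<lambda>e. \<exists>u. u \<in> primal_feasible \<and> cost (e Parameter) \<bullet> u < r e)"
proof (rule semialg_ex_vec[where g = Competitor])
  show "semialg polyfun (\<lambda>e. (\<chi> j. e (Competitor j)) \<in> primal_feasible \<and>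
      cost (e Parameter) \<bullet> (\<chi> j. e (Competitor j)) < r e)"
    by (intro semialg_conj semialg_primal_feasible semialg_less_poly polyfun_inner polyvec_cost
        polyvec_coordinates assms(1))
next
  fix e e' :: "('n, 'm) soco_var \<Rightarrow> real" and u
  assume eq: "\<And>v. v \<notin> range Competitor \<Longrightarrow> e v = e' v"
    and "u \<in> primal_feasible \<and> cost (e Parameter) \<bullet> u < r e"
  moreover have "r e = r e'" using eq by (rule assms(2))
  moreover have "e Parameter = e' Parameter" by (rule eq) auto
  ultimately show "u \<in> primal_feasible \<and> cost (e' Parameter) \<bullet> u < r e'" by simp
qed (simp add: inj_def)

lemma semialg_primal_hits:
  assumes "semialg_block_set i K"
  shows "semialg polyfun (\<lambda>e :: ('n, 'm) soco_var \<Rightarrow> real. primal_hits i K (e Parameter))"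
  unfolding primal_hits_def
proof (rule semialg_ex_vec[where g = Primal])
  have indep: "cost (e Parameter) \<bullet> (\<chi> j. e (Primal j)) = cost (e' Parameter) \<bullet> (\<chi> j. e' (Primal j))"
    if eq: "\<And>v. v \<notin> range Competitor \<Longrightarrow> e v = e' v" for e e' :: "('n, 'm) soco_var \<Rightarrow> real"
  proof -
    have "e Parameter = e' Parameter" "\<And>j. e (Primal j) = e' (Primal j)" by (auto intro!: eq)
    then show ?thesis by simp
  qed
  show "semialg polyfun (\<lambda>e :: ('n, 'm) soco_var \<Rightarrow> real.
      (\<chi> j. e (Primal j)) \<in> primal_opt (e Parameter) \<and> block (\<chi> j. e (Primal j)) i \<in> K)"
    unfolding primal_opt_iff
    by (intro semialg_conj semialg_neg semialg_primal_feasible semialg_competitor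
        assms[unfolded semialg_block_set_def, rule_format] polyfun_inner polyvec_cost polyvec_coordinates)
      (rule indep)
next
  fix e e' :: "('n, 'm) soco_var \<Rightarrow> real" and x
  assume eq: "\<And>v. v \<notin> range Primal \<Longrightarrow> e v = e' v" and "x \<in> primal_opt (e Parameter) \<and> block x i \<in> K"
  moreover have "e Parameter = e' Parameter" by (rule eq) auto
  ultimately show "x \<in> primal_opt (e' Parameter) \<and> block x i \<in> K" by simp
qed (simp add: inj_def)

lemma semialg_dual_hits:
  assumes "semialg_block_set i K"
  shows "semialg polyfun (\<lambda>e :: ('n, 'm) soco_var \<Rightarrow> real. dual_hits i K (e Parameter))"
proof -
  let ?y = "\<lambda>e :: ('n, 'm) soco_var \<Rightarrow> real. \<chi> j. e (Multiplier j)"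
    and ?s = "\<lambda>e :: ('n, 'm) soco_var \<Rightarrow> real. \<chi> j. e (Dual j)"
  have y: "?y e = ?y e'" if eq: "\<And>v. v \<notin> range Competitor \<Longrightarrow> e v = e' v" for e e'
  proof -
    have "e (Multiplier j) = e' (Multiplier j)" for j by (rule eq) auto
    then show ?thesis by simp
  qed
  have slack: "e Slack = e' Slack" if "\<And>v. v \<notin> range Competitor \<Longrightarrow> e v = e' v"
    for e e' :: "('n, 'm) soco_var \<Rightarrow> real"
    by (rule that) auto
  have gap: "semialg polyfun (\<lambda>e. \<exists>\<delta>. 0 < \<delta> \<and>
      \<not> (\<exists>u. u \<in> primal_feasible \<and> cost (e Parameter) \<bullet> u < b \<bullet> ?y e + \<delta>))"
  proof (rule semialg_ex_var[where k = Slack])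
    show "semialg polyfun (\<lambda>e. 0 < e Slack \<and>
        \<not> (\<exists>u. u \<in> primal_feasible \<and> cost (e Parameter) \<bullet> u < b \<bullet> ?y e + e Slack))"
      by (intro semialg_conj semialg_neg semialg_pos semialg_competitor polyfun_add polyfun_var
          polyfun_inner polyvec_const polyvec_coordinates) (metis y slack)
  next
    fix e e' :: "('n, 'm) soco_var \<Rightarrow> real" and \<delta>
    assume eq: "\<And>v. v \<noteq> Slack \<Longrightarrow> e v = e' v"
      and *: "0 < \<delta> \<and> \<not> (\<exists>u. u \<in> primal_feasible \<and> cost (e Parameter) \<bullet> u < b \<bullet> ?y e + \<delta>)"
    have "?y e = ?y e'" "e Parameter = e' Parameter" using eq by auto
    then show "0 < \<delta> \<and> \<not> (\<exists>u. u \<in> primal_feasible \<and> cost (e' Parameter) \<bullet> u < b \<bullet> ?y e' + \<delta>)"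
      using * by simp
  qed
  have opt: "semialg polyfun (\<lambda>e. (?y e, ?s e) \<in> dual_opt (e Parameter) \<and> block (?s e) i \<in> K)"
    unfolding dual_opt_iff dual_feasible_def mem_Collect_eq prod.case
    by (intro semialg_conj semialg_neg gap semialg_competitor semialg_cone_prod semialg_vec_eq
        assms[unfolded semialg_block_set_def, rule_format] polyfun_inner polyvec_cost polyvec_const
        polyvec_add polyvec_matrix polyvec_coordinates) (metis y)
  have multiplier: "semialg polyfun (\<lambda>e. \<exists>y. (y, ?s e) \<in> dual_opt (e Parameter) \<and> block (?s e) i \<in> K)"
  proof (rule semialg_ex_vec[where g = Multiplier])
    fix e e' :: "('n, 'm) soco_var \<Rightarrow> real" and y
    assume eq: "\<And>v. v \<notin> range Multiplier \<Longrightarrow> e v = e' v"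
      and *: "(y, ?s e) \<in> dual_opt (e Parameter) \<and> block (?s e) i \<in> K"
    have "?s e = ?s e'" "e Parameter = e' Parameter" using eq by auto
    then show "(y, ?s e') \<in> dual_opt (e' Parameter) \<and> block (?s e') i \<in> K" using * by simp
  qed (use opt in \<open>simp_all add: inj_def\<close>)
  show ?thesis
    unfolding dual_hits_def
  proof (rule semialg_ex_vec[where g = Dual])
    fix e e' :: "('n, 'm) soco_var \<Rightarrow> real" and s
    assume eq: "\<And>v. v \<notin> range Dual \<Longrightarrow> e v = e' v"
      and *: "\<exists>y. (y, s) \<in> dual_opt (e Parameter) \<and> block s i \<in> K"
    have "e Parameter = e' Parameter" using eq by auto
    then show "\<exists>y. (y, s) \<in> dual_opt (e' Parameter) \<and> block s i \<in> K" using * by simp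
  qed (use multiplier in \<open>simp_all add: inj_def\<close>)
qed

section \<open>Transition points as frontier points\<close>

text \<open>
  The sets \<open>K\<close> for which membership of some optimal block in \<open>K\<close> is relevant to the partition. Testing
  against \<open>UNIV\<close> records whether the optimal sets are nonempty, on which the vacuous truth of
  the defining condition of \<open>\<T>\<^sub>1\<close> depends.
\<close>

definition block_tests :: "nat \<Rightarrow> (nat \<Rightarrow> real) set set" where
  "block_tests i = {soc_int (n i), soc_bd (n i) - {zero_block}, - {zero_block}, UNIV}"

lemma semialg_block_tests: "K \<in> block_tests i \<Longrightarrow> semialg_block_set i K"
  unfolding block_tests_def Compl_eq_Diff_UNIV soc_bd_eq
  by (auto intro!: semialg_block_minus semialg_soc_int semialg_soc semialg_zero_block semialg_UNIV)

lemma finite_frontier_hits: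
  assumes "K \<in> block_tests i"
  shows "finite (frontier {\<epsilon>. primal_hits i K \<epsilon>})" "finite (frontier {\<epsilon>. dual_hits i K \<epsilon>})"
  using finite_frontier_semialg[OF semialg_primal_hits[OF semialg_block_tests[OF assms]], of _ Parameter]
    finite_frontier_semialg[OF semialg_dual_hits[OF semialg_block_tests[OF assms]], of _ Parameter]
  by simp_all

lemma optimal_partition_eqI:
  assumes "\<And>i K. i \<in> {1..p} \<Longrightarrow> K \<in> block_tests i \<Longrightarrow>
    (primal_hits i K \<epsilon> \<longleftrightarrow> primal_hits i K \<epsilon>') \<and> (dual_hits i K \<epsilon> \<longleftrightarrow> dual_hits i K \<epsilon>')"
  shows "optimal_partition \<epsilon> = optimal_partition \<epsilon>'"
proof -
  have B: "part_B \<epsilon> = {i \<in> {1..p}. primal_hits i (soc_int (n i)) \<epsilon>}" for \<epsilon>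
    by (auto simp: part_B_def primal_hits_def)
  have N: "part_N \<epsilon> = {i \<in> {1..p}. dual_hits i (soc_int (n i)) \<epsilon>}" for \<epsilon>
    by (auto simp: part_N_def dual_hits_def)
  have R: "part_R \<epsilon> = {i \<in> {1..p}. primal_hits i (soc_bd (n i) - {zero_block}) \<epsilon> \<and>
      dual_hits i (soc_bd (n i) - {zero_block}) \<epsilon>}" for \<epsilon>
    unfolding part_R_def primal_hits_def dual_hits_def by blast
  \<comment> \<open>The primal and dual conditions are separated, which requires the two empty cases to be listed.\<close>
  have T1: "part_T1 \<epsilon> = {i \<in> part_T \<epsilon>. \<not> primal_hits i UNIV \<epsilon> \<or> \<not> dual_hits i UNIV \<epsilon> \<or>
      (\<not> primal_hits i (- {zero_block}) \<epsilon> \<and> \<not> dual_hits i (- {zero_block}) \<epsilon>)}" for \<epsilon>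
    unfolding part_T1_def primal_hits_def dual_hits_def by blast
  have T2: "part_T2 \<epsilon> = {i \<in> part_T \<epsilon>. primal_hits i (soc_bd (n i) - {zero_block}) \<epsilon> \<and>
      \<not> dual_hits i (- {zero_block}) \<epsilon>}" for \<epsilon>
    unfolding part_T2_def primal_hits_def dual_hits_def by blast
  have T3: "part_T3 \<epsilon> = {i \<in> part_T \<epsilon>. dual_hits i (soc_bd (n i) - {zero_block}) \<epsilon> \<and>
      \<not> primal_hits i (- {zero_block}) \<epsilon>}" for \<epsilon>
    unfolding part_T3_def primal_hits_def dual_hits_def by blast
  have eq: "part_B \<epsilon> = part_B \<epsilon>'" "part_N \<epsilon> = part_N \<epsilon>'" "part_R \<epsilon> = part_R \<epsilon>'"
    unfolding B N R using assms by (auto simp: block_tests_def)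
  then have T: "part_T \<epsilon> = part_T \<epsilon>'" by (simp add: part_T_def)
  have sub: "i \<in> {1..p}" if "i \<in> part_T \<epsilon>'" for i using that by (auto simp: part_T_def)
  have "part_T1 \<epsilon> = part_T1 \<epsilon>'" "part_T2 \<epsilon> = part_T2 \<epsilon>'" "part_T3 \<epsilon> = part_T3 \<epsilon>'"
    unfolding T1 T2 T3 T using assms sub by (auto simp: block_tests_def)
  with eq T show ?thesis by (simp add: optimal_partition_def)
qed

lemma eventually_eq_off_frontier:
  assumes "x \<notin> frontier {x. P x}"
  shows "eventually (\<lambda>z. P z \<longleftrightarrow> P x) (nhds x)"
proof -
  have "x \<in> interior {x. P x} \<or> x \<in> interior (- {x. P x})"
    using assms by (auto simp: frontier_def interior_closure)
  then show ?thesis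
  proof
    assume x: "x \<in> interior {x. P x}"
    then have "P x" using interior_subset by blast
    then show ?thesis
      using eventually_nhds_in_open[OF open_interior x] interior_subset[of "{x. P x}"]
      by (auto elim!: eventually_mono)
  next
    assume x: "x \<in> interior (- {x. P x})"
    then have "\<not> P x" using interior_subset by blast
    then show ?thesis
      using eventually_nhds_in_open[OF open_interior x] interior_subset[of "- {x. P x}"]
      by (auto elim!: eventually_mono)
  qed
qed

text \<open>
  Away from the frontiers every test keeps its answer on a neighbourhood, hence so does the whole
  partition, which a transition point forbids.
\<close>

lemma transition_point_in_frontier:
  assumes "transition_point \<epsilon>\<^sub>0"
  shows "\<exists>i\<in>{1..p}. \<exists>K\<in>block_tests i.
    \<epsilon>\<^sub>0 \<in> frontier {\<epsilon>. primal_hits i K \<epsilon>} \<or> \<epsilon>\<^sub>0 \<in> frontier {\<epsilon>. dual_hits i K \<epsilon>}"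
proof (rule ccontr)
  assume "\<not> ?thesis"
  then have "eventually (\<lambda>\<epsilon>. (primal_hits i K \<epsilon> \<longleftrightarrow> primal_hits i K \<epsilon>\<^sub>0) \<and>
      (dual_hits i K \<epsilon> \<longleftrightarrow> dual_hits i K \<epsilon>\<^sub>0)) (nhds \<epsilon>\<^sub>0)" if "i \<in> {1..p}" "K \<in> block_tests i" for i K
    using that by (intro eventually_conj eventually_eq_off_frontier) auto
  then have "eventually (\<lambda>\<epsilon>. \<forall>i\<in>{1..p}. \<forall>K\<in>block_tests i. (primal_hits i K \<epsilon> \<longleftrightarrow> primal_hits i K \<epsilon>\<^sub>0) \<and>
      (dual_hits i K \<epsilon> \<longleftrightarrow> dual_hits i K \<epsilon>\<^sub>0)) (nhds \<epsilon>\<^sub>0)"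
    by (intro eventually_ball_finite ballI) (auto simp: block_tests_def)
  moreover have "eventually (\<lambda>\<epsilon>. \<epsilon> \<in> interior \<E>) (nhds \<epsilon>\<^sub>0)"
    using assms by (intro eventually_nhds_in_open) (auto simp: transition_point_def)
  ultimately have "eventually (\<lambda>\<epsilon>. \<epsilon> \<in> interior \<E> \<and> optimal_partition \<epsilon> = optimal_partition \<epsilon>\<^sub>0) (nhds \<epsilon>\<^sub>0)"
    by eventually_elim (auto intro: optimal_partition_eqI)
  then obtain \<delta> where "\<delta> > 0" and \<delta>: "\<And>\<epsilon>. dist \<epsilon> \<epsilon>\<^sub>0 < \<delta> \<Longrightarrow>
      \<epsilon> \<in> interior \<E> \<and> optimal_partition \<epsilon> = optimal_partition \<epsilon>\<^sub>0"
    unfolding eventually_nhds_metric by blast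
  then have "\<epsilon> \<in> interior \<E> \<and> optimal_partition \<epsilon> = optimal_partition \<epsilon>\<^sub>0"
    if "\<epsilon> \<in> {\<epsilon>\<^sub>0 - \<delta><..<\<epsilon>\<^sub>0 + \<delta>}" for \<epsilon>
    using that by (intro \<delta>) (auto simp: dist_real_def)
  then show False using assms \<open>\<delta> > 0\<close> unfolding transition_point_def by blast
qed

lemma finite_transition_points: "finite {\<epsilon>. transition_point \<epsilon>}"
proof (rule finite_subset)
  show "{\<epsilon>. transition_point \<epsilon>} \<subseteq> (\<Union>i\<in>{1..p}. \<Union>K\<in>block_tests i.
      frontier {\<epsilon>. primal_hits i K \<epsilon>} \<union> frontier {\<epsilon>. dual_hits i K \<epsilon>})"
    using transition_point_in_frontier by blast
  have "finite (block_tests i)" for i by (simp add: block_tests_def)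
  then show "finite (\<Union>i\<in>{1..p}. \<Union>K\<in>block_tests i.
      frontier {\<epsilon>. primal_hits i K \<epsilon>} \<union> frontier {\<epsilon>. dual_hits i K \<epsilon>})"
    using finite_frontier_hits by simp
qed

end

theorem theorem1:
  fixes p :: nat
    and n :: "nat \<Rightarrow> nat"
    and idx :: "nat \<Rightarrow> nat \<Rightarrow> 'n::finite"
    and A :: "real ^ 'n ^ 'm::finite"
    and b :: "real ^ 'm"
    and c cbar :: "real ^ 'n"
  assumes "parametric_soco p n idx A b c cbar"
  shows "finite {\<epsilon>. soco_data.transition_point p n idx A b c cbar \<epsilon>}"
  by (rule soco_data.finite_transition_points)

end
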